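(* Let $W=\{w_1,\dots,w_6\}\subset\mathbb{Z}^3$ with $w_1=(1,0,0)$, $w_2=(0,1,0)$, $w_3=(0,0,1)$, $w_4=(-1,0,0)$, $w_5=(0,-1,0)$, $w_6=(0,0,-1)$, let $V=W+4\mathbb{Z}^3$, and let $\Gamma=(V,E)$ be the graph in which distinct $u,v\in V$ are adjacent iff $\|u-v\|\le 2$ (Euclidean norm). Let $\mathbb{Z}^3$ act on $V$ by $(a,b,c)\cdot(m,n,p)=(m+4a,n+4b,p+4c)$, and let $A$ be the adjacency operator on $\ell^2(V)$. Put $R=\mathbb{C}[x^{\pm1},y^{\pm1},z^{\pm1}]$, let $K\subset R^6$ be the $R$-module of (Floquet–Bloch transforms of) finitely supported eigenfunctions of $A$ with eigenvalue $\lambda=-2$, and let $$f^{(1)}=(0,\,-y+yz,\,z-yz,\,0,\,1-z,\,-1+y)^T,$$ $$f^{(2)}=(x-xz,\,0,\,-z+xz,\,-1+z,\,0,\,1-x)^T,$$ $$f^{(3)}=(-x+xy,\,y-xy,\,0,\,1-y,\,1-x\cdot 0-2+x,\,0)^T=(-x+xy,\,y-xy,\,0,\,1-y,\,-1+x,\,0)^T .$$ Then $K$ is generated as an $R$-module by $f^{(1)},f^{(2)},f^{(3)}$, and its first syzygy module with respect to these generators, $\{(h_1,h_2,h_3)\in R^3: h_1f^{(1)}+h_2f^{(2)}+h_3f^{(3)}=0\}$, is generated by $(1-x,1-y,1-z)$. Equivalently, there is a free resolution $$0\to R\to R^3\to K\to 0$$ with first map $h\mapsto(h(1-x),h(1-y),h(1-z))$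 and second map $(h_1,h_2,h_3)\mapsto h_1f^{(1)}+h_2f^{(2)}+h_3f^{(3)}$. In particular, $\nu(\{-2\})=\frac16(3-1)=\frac13$.
   Context: The adjacency operator is $Af(v)=\sum_{w\sim v}f(w)$. The Floquet–Bloch transform of a finitely supported $f:V\to\mathbb{C}$ is the vector $\widehat f=(\widehat f_1,\dots,\widehat f_6)\in R^6$ with $$\widehat f_i=\sum_{(a,b,c)\in\mathbb{Z}^3} f\bigl((a,b,c)\cdot w_i\bigr)\,x^{-a}y^{-b}z^{-c}.$$ This is a linear bijection from finitely supported functions onto $R^6$; $K$ is the set of $\widehat f$ with $f$ finitely supported and $Af=-2f$, and it is an $R$-submodule of $R^6$. Density of states: $\nu(\{\lambda\})=\frac1{|W|}\operatorname{tr}(E(\{\lambda\})I_W)$, where $E(\{\lambda\})$ is the orthogonal projection of $\ell^2(V)$ onto $\{f\in\ell^2(V):Af=\lambda f\}$ and $I_W$ is the projection onto functions supported on $W$. *)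

theory Defs
  imports "HOL-Analysis.Analysis" "HOL-Library.Poly_Mapping"
begin

type_synonym point = "int \<times> int \<times> int"

definition w :: "point ^ 6" where
  "w = vector [(1,0,0), (0,1,0), (0,0,1), (-1,0,0), (0,-1,0), (0,0,-1)]"

definition W :: "point set" where
  "W = range (\<lambda>i. w $ i)"

definition act :: "point \<Rightarrow> point \<Rightarrow> point" where
  "act = (\<lambda>(a, b, c) (m, n, p). (m + 4 * a, n + 4 * b, p + 4 * c))"

definition V :: "point set" where
  "V = {u + (4 * a, 4 * b, 4 * c) | u a b c. u \<in> W}"

text \<open>The product norm on \<^typ>\<open>real \<times> real \<times> real\<close> is the Euclidean one.\<close>

definition euclid :: "point \<Rightarrow> real \<times> real \<times> real" where
  "euclid = (\<lambda>(m, n, p). (of_int m, of_int n, of_int p))"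

definition adjacent :: "point \<Rightarrow> point \<Rightarrow> bool" where
  "adjacent u v \<longleftrightarrow> u \<in> V \<and> v \<in> V \<and> u \<noteq> v \<and> norm (euclid u - euclid v) \<le> 2"

text \<open>A function on \<^term>\<open>V\<close> is encoded as a function on all points that vanishes off \<^term>\<open>V\<close>.
  The graph is locally finite, so the sum below is a finite one.\<close>

definition functions_on_V :: "(point \<Rightarrow> complex) set" where
  "functions_on_V = {f. \<forall>v. v \<notin> V \<longrightarrow> f v = 0}"

definition adj_op :: "(point \<Rightarrow> complex) \<Rightarrow> point \<Rightarrow> complex" where
  "adj_op f v = (\<Sum>u | adjacent u v. f u)"

definition finsupp :: "(point \<Rightarrow> complex) set" where
  "finsupp = {f \<in> functions_on_V. finite {v. f v \<noteq> 0}}"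

text \<open>The Laurent polynomial ring in three variables is the group algebra of
  \<open>\<int>\<^sup>3\<close>: \<^term>\<open>Poly_Mapping.single (a, b, c) k\<close> is the monomial \<open>k x\<^sup>a y\<^sup>b z\<^sup>c\<close>,
  and multiplication is convolution.\<close>

type_synonym laurent = "point \<Rightarrow>\<^sub>0 complex"

definition X :: laurent where "X = Poly_Mapping.single (1, 0, 0) 1"
definition Y :: laurent where "Y = Poly_Mapping.single (0, 1, 0) 1"
definition Z :: laurent where "Z = Poly_Mapping.single (0, 0, 1) 1"

text \<open>\<^const>\<open>Sum_any\<close> sums over all points at which the summand is nonzero; for finitely
  supported \<open>f\<close> there are finitely many.\<close>

definition floquet :: "(point \<Rightarrow> complex) \<Rightarrow> laurent ^ 6" where
  "floquet f = (\<chi> i. Sum_any (\<lambda>(a, b, c).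
     Poly_Mapping.single (- a, - b, - c) (f (act (a, b, c) (w $ i)))))"

definition eigenmodule :: "complex \<Rightarrow> (laurent ^ 6) set" where
  "eigenmodule \<mu> = {floquet f | f. f \<in> finsupp \<and> adj_op f = (\<lambda>v. \<mu> * f v)}"

definition f1 :: "laurent ^ 6" where
  "f1 = vector [0, - Y + Y * Z, Z - Y * Z, 0, 1 - Z, - 1 + Y]"

definition f2 :: "laurent ^ 6" where
  "f2 = vector [X - X * Z, 0, - Z + X * Z, - 1 + Z, 0, 1 - X]"

definition f3 :: "laurent ^ 6" where
  "f3 = vector [- X + X * Y, Y - X * Y, 0, 1 - Y, - 1 + X, 0]"

definition first_map :: "laurent \<Rightarrow> laurent ^ 3" where
  "first_map h = vector [h * (1 - X), h * (1 - Y), h * (1 - Z)]"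

definition second_map :: "laurent ^ 3 \<Rightarrow> laurent ^ 6" where
  "second_map h = h $ 1 *s f1 + h $ 2 *s f2 + h $ 3 *s f3"

definition ell2 :: "(point \<Rightarrow> complex) set" where
  "ell2 = {f \<in> functions_on_V. (\<lambda>v. (cmod (f v))\<^sup>2) summable_on V}"

definition ell2_inner :: "(point \<Rightarrow> complex) \<Rightarrow> (point \<Rightarrow> complex) \<Rightarrow> complex" where
  "ell2_inner f g = (\<Sum>\<^sub>\<infinity>v\<in>V. f v * cnj (g v))"

definition ell2_eigenspace :: "complex \<Rightarrow> (point \<Rightarrow> complex) set" where
  "ell2_eigenspace \<mu> = {f \<in> ell2. adj_op f = (\<lambda>v. \<mu> * f v)}"

text \<open>Orthogonal projection of \<open>f \<in> ell2\<close> onto a closed subspace \<open>S\<close>.\<close>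

definition orth_proj ::
    "(point \<Rightarrow> complex) set \<Rightarrow> (point \<Rightarrow> complex) \<Rightarrow> (point \<Rightarrow> complex)" where
  "orth_proj S f = (THE g. g \<in> S \<and> (\<forall>h\<in>S. ell2_inner (\<lambda>v. f v - g v) h = 0))"

definition spectral_proj :: "complex \<Rightarrow> (point \<Rightarrow> complex) \<Rightarrow> (point \<Rightarrow> complex)" where
  "spectral_proj \<mu> = orth_proj (ell2_eigenspace \<mu>)"

definition restrict_W :: "(point \<Rightarrow> complex) \<Rightarrow> (point \<Rightarrow> complex)" where
  "restrict_W f = (\<lambda>v. if v \<in> W then f v else 0)"

definition delta :: "point \<Rightarrow> point \<Rightarrow> complex" where
  "delta u = (\<lambda>v. if v = u then 1 else 0)"

text \<open>Trace of a trace-class operator on \<^term>\<open>ell2\<close>, in the standard orthonormal basis.\<close>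

definition trace_ell2 :: "((point \<Rightarrow> complex) \<Rightarrow> (point \<Rightarrow> complex)) \<Rightarrow> complex" where
  "trace_ell2 T = (\<Sum>\<^sub>\<infinity>v\<in>V. ell2_inner (T (delta v)) (delta v))"

definition density_of_states :: "complex \<Rightarrow> complex" where
  "density_of_states \<mu> = 1 / of_nat (card W) * trace_ell2 (spectral_proj \<mu> \<circ> restrict_W)"

end

theory Submission
  imports Defs
begin

text \<open>
  \<open>\<Gamma>\<close> consists of octahedra centred at the points of \<open>4\<int>\<^sup>3\<close>, each a complete graph on six
  vertices, with neighbouring octahedra joined by a single edge. Hence it is the line graph of the
  subdivided cubic lattice, and \<open>A f = - 2 f\<close> says that \<open>f\<close> is a divergence-free flow on the
  cubic lattice: it changes sign along every joining edge and sums to zero over every octahedron.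
  Under the Floquet transform the flows become the triples \<open>(g\<^sub>1, g\<^sub>2, g\<^sub>3)\<close> with
  \<open>(1 - x) g\<^sub>1 + (1 - y) g\<^sub>2 + (1 - z) g\<^sub>3 = 0\<close>, so the resolution is the Koszul complex of
  \<open>1 - x, 1 - y, 1 - z\<close>, which is exact because setting \<open>x = 1\<close> and \<open>y = 1\<close> successively detects
  divisibility.

  For the density of states, let \<open>t(m)\<close> be the sum over \<open>i\<close> of the matrix entries of the spectral
  projection \<open>E\<close> between \<open>w\<^sub>i\<close> and its translate by \<open>m\<close>. Orthogonality of \<open>\<delta>\<^sub>u - E \<delta>\<^sub>u\<close> to the
  plaquette flows, together with the vanishing divergence of \<open>E \<delta>\<^sub>u\<close>, gives
  \<open>t(m) - t(m + w\<^sub>1) = 2 [m = 0] - 2 [m = - w\<^sub>1]\<close>. As \<open>t\<close> decays, it vanishes at \<open>w\<^sub>1\<close>, so the trace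
  \<open>t(0)\<close> over a fundamental domain is \<open>2\<close>.
\<close>

section \<open>Geometry of the graph\<close>

lemma exhaust_6: "i = 1 \<or> i = 2 \<or> i = 3 \<or> i = 4 \<or> i = 5 \<or> i = 6" for i :: 6
proof (induct i)
  case (of_int z)
  then have "0 \<le> z" and "z < 6" by simp_all
  then have "z = 0 \<or> z = 1 \<or> z = 2 \<or> z = 3 \<or> z = 4 \<or> z = 5" by arith
  then show ?case by auto
qed

lemma forall_6: "(\<forall>i::6. P i) \<longleftrightarrow> P 1 \<and> P 2 \<and> P 3 \<and> P 4 \<and> P 5 \<and> P 6"
  by (metis exhaust_6)

lemma UNIV_6: "UNIV = {1, 2, 3, 4, 5, 6::6}"
  using exhaust_6 by auto

lemma sum_6: "sum f (UNIV::6 set) = f 1 + f 2 + f 3 + f 4 + f 5 + f 6"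
  unfolding UNIV_6 by (simp add: ac_simps)

lemma vector_6:
  fixes a :: "'a::zero"
  shows "(vector [a, b, c, d, e, f] :: 'a ^ 6) $ 1 = a"
    "(vector [a, b, c, d, e, f] :: 'a ^ 6) $ 2 = b"
    "(vector [a, b, c, d, e, f] :: 'a ^ 6) $ 3 = c"
    "(vector [a, b, c, d, e, f] :: 'a ^ 6) $ 4 = d"
    "(vector [a, b, c, d, e, f] :: 'a ^ 6) $ 5 = e"
    "(vector [a, b, c, d, e, f] :: 'a ^ 6) $ 6 = f"
  unfolding vector_def by simp_all

lemma w_simps:
  "w $ 1 = (1, 0, 0)" "w $ 2 = (0, 1, 0)" "w $ 3 = (0, 0, 1)"
  "w $ 4 = (- 1, 0, 0)" "w $ 5 = (0, - 1, 0)" "w $ 6 = (0, 0, - 1)"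
  unfolding w_def by (simp_all add: vector_6)

lemma numeral_mod_6: "(7::6) = 1" "(8::6) = 2" "(9::6) = 3"
  by simp_all

text \<open>Arithmetic in the type \<open>6\<close> is modulo 6, and opposite vectors are listed
  three places apart. So \<open>i + 3\<close> serves throughout as the index opposite to
  \<open>i\<close>.\<close>

lemma w_opposite: "w $ (i + 3) = - (w $ i)"
  using exhaust_6[of i] by (auto simp: w_simps numeral_mod_6)

lemma inj_w: "inj (\<lambda>i. w $ i)"
proof -
  have "\<forall>i j. w $ i = w $ j \<longrightarrow> i = j"
    unfolding forall_6 w_simps by simp
  then show ?thesis
    by (simp add: inj_def)
qed

text \<open>The vertex in direction \<open>w $ i\<close> of the octahedron centred at
  \<open>4 n\<close>; this parametrises \<open>V\<close> by a direction and a cell.\<close>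

definition site :: "6 \<Rightarrow> point \<Rightarrow> point" where
  "site i n = act n (w $ i)"

lemma abs_w_le_1:
  "\<bar>fst (w $ i)\<bar> \<le> 1" "\<bar>fst (snd (w $ i))\<bar> \<le> 1" "\<bar>snd (snd (w $ i))\<bar> \<le> 1"
  using exhaust_6[of i] by (auto simp: w_simps)

text \<open>The coordinates of \<open>w $ i\<close> lie between -1 and 1, so their residues modulo 4
  determine them; hence both the cell and the direction can be recovered.\<close>

lemma site_eq_iff [simp]: "site i m = site j n \<longleftrightarrow> i = j \<and> m = n"
proof
  assume eq: "site i m = site j n"
  obtain a b c where m: "m = (a, b, c)" by (cases m)
  obtain a' b' c' where n: "n = (a', b', c')" by (cases n)
  obtain x y z where wi: "w $ i = (x, y, z)" by (cases "w $ i")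
  obtain x' y' z' where wj: "w $ j = (x', y', z')" by (cases "w $ j")
  have base: "c = c'" if "\<bar>x\<bar> \<le> 1" "\<bar>x'\<bar> \<le> 1" "x + 4 * c = x' + 4 * c'" for x x' c c' :: int
    using that by arith
  have "a = a'" "b = b'" "c = c'"
    using eq abs_w_le_1[of i] abs_w_le_1[of j]
      base[of x x' a a'] base[of y y' b b'] base[of z z' c c']
    by (simp_all add: m n wi wj site_def act_def)
  then have "m = n" and "w $ i = w $ j"
    using eq by (auto simp: m n wi wj site_def act_def)
  then show "i = j \<and> m = n"
    using inj_w by (auto dest: injD)
qed auto

lemma V_eq_sites: "V = range (\<lambda>(i, n). site i n)"
proof -
  have site: "site i (a, b, c) = w $ i + (4 * a, 4 * b, 4 * c)" for i a b c
    by (cases "w $ i") (simp add: site_def act_def)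
  show ?thesis
  proof (intro equalityI subsetI)
    show "v \<in> range (\<lambda>(i, n). site i n)" if v: "v \<in> V" for v
    proof -
      obtain u a b c where "u \<in> W" "v = u + (4 * a, 4 * b, 4 * c)"
        using v unfolding V_def by blast
      then obtain i where "v = site i (a, b, c)"
        by (auto simp: W_def site)
      then show ?thesis
        by (auto intro: image_eqI[of _ _ "(i, (a, b, c))"])
    qed
    show "v \<in> V" if "v \<in> range (\<lambda>(i, n). site i n)" for v
      using that unfolding V_def W_def by (fastforce simp: site)
  qed
qed

lemma site_in_V [simp]: "site i n \<in> V"
  by (auto simp: V_eq_sites)

lemma V_cases:
  assumes "v \<in> V"
  obtains i n where "v = site i n"
  using assms by (auto simp: V_eq_sites)

lemma W_eq_sites: "W = range (\<lambda>i. site i 0)"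
  by (auto simp: W_def site_def act_def zero_prod_def split: prod.splits)

text \<open>The far end of the edge leaving cell \<open>n\<close> in direction \<open>w $ i\<close>:
  the vertex \<open>4 (n + w_i) - w_i\<close>, at distance 2 from \<open>4 n + w_i\<close>.\<close>

definition partner :: "6 \<Rightarrow> point \<Rightarrow> point" where
  "partner i n = site (i + 3) (n + w $ i)"

section \<open>Adjacency in terms of cells and directions\<close>

lemma norm_euclid_le_2_iff:
  "norm (euclid (a, b, c) - euclid (a', b', c')) \<le> 2 \<longleftrightarrow>
    (a - a')\<^sup>2 + (b - b')\<^sup>2 + (c - c')\<^sup>2 \<le> 4"
proof -
  have "norm (euclid (a, b, c) - euclid (a', b', c')) =
      sqrt (of_int ((a - a')\<^sup>2 + (b - b')\<^sup>2 + (c - c')\<^sup>2))"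
    by (simp add: euclid_def norm_Pair)
  also have "\<dots> \<le> 2 \<longleftrightarrow> of_int ((a - a')\<^sup>2 + (b - b')\<^sup>2 + (c - c')\<^sup>2) \<le> (2::real)\<^sup>2"
    by (metis abs_numeral real_sqrt_abs real_sqrt_le_iff)
  also have "\<dots> \<longleftrightarrow> (a - a')\<^sup>2 + (b - b')\<^sup>2 + (c - c')\<^sup>2 \<le> 4"
    by (simp flip: of_int_le_iff[where 'a=real])
  finally show ?thesis .
qed

lemma abs_le_2_of_square_sum_le:
  fixes a b c :: int
  assumes "a\<^sup>2 + b\<^sup>2 + c\<^sup>2 \<le> 4"
  shows "\<bar>a\<bar> \<le> 2" "\<bar>b\<bar> \<le> 2" "\<bar>c\<bar> \<le> 2"
proof -
  have "a\<^sup>2 \<le> 2\<^sup>2" "b\<^sup>2 \<le> 2\<^sup>2" "c\<^sup>2 \<le> 2\<^sup>2"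
    using assms zero_le_power2[of a] zero_le_power2[of b] zero_le_power2[of c]
    unfolding power2_eq_square[of "2::int"] by linarith+
  then show "\<bar>a\<bar> \<le> 2" "\<bar>b\<bar> \<le> 2" "\<bar>c\<bar> \<le> 2"
    using power2_le_iff_abs_le[of 2 a] power2_le_iff_abs_le[of 2 b] power2_le_iff_abs_le[of 2 c]
    by simp_all
qed

text \<open>Inside one octahedron all distances are at most 2. Between cells, each coordinate in
  which the cells differ forces the directions to differ by 2 there, which happens only for opposite
  vertices on that axis.\<close>

lemma adjacent_site_iff:
  "adjacent u (site i n) \<longleftrightarrow> u \<noteq> site i n \<and> (u \<in> range (\<lambda>j. site j n) \<or> u = partner i n)"
proof (cases "u \<in> V")
  case True
  then obtain j m where u: "u = site j m" by (rule V_cases)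
  obtain a b c where n: "n = (a, b, c)" by (cases n)
  obtain a' b' c' where m: "m = (a', b', c')" by (cases m)
  define p q r where "p = a' - a" and "q = b' - b" and "r = c' - c"
  then have pqr: "a' = a + p" "b' = b + q" "c' = c + r" by auto
  obtain x y z where wi: "w $ i = (x, y, z)" by (cases "w $ i")
  obtain x' y' z' where wj: "w $ j = (x', y', z')" by (cases "w $ j")
  \<comment> \<open>A difference of 2 in absolute value pins down the axis and the orientation of
    both directions, so two cell coordinates cannot both change.\<close>
  have opposite:
    "x' - x = 2 \<Longrightarrow> i = 4 \<and> j = 1" "x' - x = - 2 \<Longrightarrow> i = 1 \<and> j = 4"
    "y' - y = 2 \<Longrightarrow> i = 5 \<and> j = 2" "y' - y = - 2 \<Longrightarrow> i = 2 \<and> j = 5"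
    "z' - z = 2 \<Longrightarrow> i = 6 \<and> j = 3" "z' - z = - 2 \<Longrightarrow> i = 3 \<and> j = 6"
    using exhaust_6[of i] exhaust_6[of j] wi wj by (auto simp: w_simps)
  have "norm (euclid u - euclid (site i n)) \<le> 2 \<longleftrightarrow>
      (x' - x + 4 * p)\<^sup>2 + (y' - y + 4 * q)\<^sup>2 + (z' - z + 4 * r)\<^sup>2 \<le> 4"
    unfolding u n m site_def act_def wi wj pqr
    by (simp add: norm_euclid_le_2_iff algebra_simps)
  also have "\<dots> \<longleftrightarrow> (p, q, r) = 0 \<or> (j = i + 3 \<and> (p, q, r) = w $ i)"
    (is "?L \<longleftrightarrow> ?R")
  proof
    assume L: ?L
    have bounds: "\<bar>x' - x + 4 * p\<bar> \<le> 2" "\<bar>y' - y + 4 * q\<bar> \<le> 2" "\<bar>z' - z + 4 * r\<bar> \<le> 2"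
      using abs_le_2_of_square_sum_le[OF L] by auto
    have shift: "d = 0 \<or> c' - c = 2 \<and> d = - 1 \<or> c' - c = - 2 \<and> d = 1"
      if "\<bar>c' - c + 4 * d\<bar> \<le> 2" "\<bar>c\<bar> \<le> 1" "\<bar>c'\<bar> \<le> 1" for c c' d :: int
      using that by arith
    have "p = 0 \<or> x' - x = 2 \<and> p = - 1 \<or> x' - x = - 2 \<and> p = 1"
      and "q = 0 \<or> y' - y = 2 \<and> q = - 1 \<or> y' - y = - 2 \<and> q = 1"
      and "r = 0 \<or> z' - z = 2 \<and> r = - 1 \<or> z' - z = - 2 \<and> r = 1"
      using shift[OF bounds(1)] shift[OF bounds(2)] shift[OF bounds(3)] abs_w_le_1[of i] abs_w_le_1[of j]
      by (simp_all add: wi wj)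
    then have "p = 0 \<or> i = 4 \<and> j = 1 \<and> p = - 1 \<or> i = 1 \<and> j = 4 \<and> p = 1"
      and "q = 0 \<or> i = 5 \<and> j = 2 \<and> q = - 1 \<or> i = 2 \<and> j = 5 \<and> q = 1"
      and "r = 0 \<or> i = 6 \<and> j = 3 \<and> r = - 1 \<or> i = 3 \<and> j = 6 \<and> r = 1"
      using opposite by blast+
    then show ?R
      by (elim disjE) (simp_all add: w_simps zero_prod_def numeral_mod_6)
  next
    assume ?R
    then show ?L
    proof
      assume "(p, q, r) = 0"
      then show ?L
        using exhaust_6[of i] exhaust_6[of j] wi[symmetric] wj[symmetric]
        by (elim disjE; simp add: w_simps zero_prod_def)
    next
      assume "j = i + 3 \<and> (p, q, r) = w $ i"
      then show ?L
        using exhaust_6[of i] wi[symmetric] wj[symmetric]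
        by (elim disjE; simp add: w_simps numeral_mod_6)
    qed
  qed
  also have "\<dots> \<longleftrightarrow> u \<in> range (\<lambda>j. site j n) \<or> u = partner i n"
    unfolding u partner_def n m pqr by (auto simp: zero_prod_def wi)
  finally show ?thesis
    using True by (auto simp: adjacent_def)
next
  case False
  then show ?thesis
    by (auto simp: adjacent_def partner_def)
qed

lemma opposite_index [simp]: "i + 3 \<noteq> i" "i + 3 + 3 = i" for i :: 6
  using exhaust_6[of i] by auto

lemma partner_partner [simp]: "partner (i + 3) (n + w $ i) = site i n"
  by (simp add: partner_def w_opposite)

lemma adj_op_site: "adj_op f (site i n) = (\<Sum>j\<in>UNIV. f (site j n)) - f (site i n) + f (partner i n)"
proof -
  have *: "{u. adjacent u (site i n)} = insert (partner i n) ((\<lambda>j. site j n) ` (UNIV - {i}))"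
    by (auto simp: adjacent_site_iff partner_def)
  have "partner i n \<notin> (\<lambda>j. site j n) ` (UNIV - {i})"
    using exhaust_6[of i] by (auto simp: partner_def w_simps zero_prod_def)
  then have "adj_op f (site i n) = f (partner i n) + (\<Sum>j\<in>UNIV - {i}. f (site j n))"
    unfolding adj_op_def * by (simp add: sum.reindex inj_on_def)
  then show ?thesis
    by (simp add: sum_diff1)
qed

lemma adj_op_outside: "v \<notin> V \<Longrightarrow> adj_op f v = 0"
  by (simp add: adj_op_def adjacent_def)

text \<open>The two ends of an edge between octahedra stand for the two orientations of an edge of the
  cubic lattice.\<close>

definition flow :: "(point \<Rightarrow> complex) \<Rightarrow> bool" where
  "flow f \<longleftrightarrow> (\<forall>n. (\<Sum>j\<in>UNIV. f (site j n)) = 0) \<and> (\<forall>i n. f (partner i n) = - f (site i n))"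

lemma flow_sum: "flow f \<Longrightarrow> (\<Sum>j\<in>UNIV. f (site j n)) = 0"
  and flow_partner: "flow f \<Longrightarrow> f (partner i n) = - f (site i n)"
  unfolding flow_def by blast+

text \<open>Decay along one axis is what makes a quantity invariant under translation along that
  axis vanish; it covers finitely supported and square-summable functions alike.\<close>

definition decaying :: "(point \<Rightarrow> complex) \<Rightarrow> bool" where
  "decaying f \<longleftrightarrow> (\<forall>j a b c. (\<lambda>k. f (site j (a + int k, b, c))) \<longlonglongrightarrow> 0)"

lemma flow_imp_eigenfunction:
  assumes "f \<in> functions_on_V" "flow f"
  shows "adj_op f = (\<lambda>v. - 2 * f v)"
proof
  show "adj_op f v = - 2 * f v" for v
  proof (cases "v \<in> V")
    case True
    then obtain i n where "v = site i n" by (rule V_cases)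
    then show ?thesis
      using assms(2) by (simp add: adj_op_site flow_sum flow_partner)
  next
    case False
    then have "f v = 0"
      using assms(1) unfolding functions_on_V_def by blast
    with False show ?thesis
      by (simp add: adj_op_outside)
  qed
qed

text \<open>The eigenvalue equation at the two ends of an edge shows that the sums over the two
  octahedra joined by it agree, so for a decaying function they all vanish.\<close>

lemma eigenfunction_imp_flow:
  assumes "adj_op f = (\<lambda>v. - 2 * f v)" "decaying f"
  shows "flow f"
proof -
  define S where "S n = (\<Sum>j\<in>UNIV. f (site j n))" for n
  have eq: "S n + f (site i n) + f (partner i n) = 0" for i n
  proof -
    have "S n - f (site i n) + f (partner i n) = - 2 * f (site i n)"
      using fun_cong[OF assms(1), of "site i n"] unfolding adj_op_site S_def .
    then show ?thesis by algebra
  qed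
  have step: "S (n + w $ i) = S n" for i n
  proof -
    have "S (n + w $ i) + f (partner i n) + f (site i n) = 0"
      using eq[of "n + w $ i" "i + 3"] unfolding partner_partner partner_def[symmetric] .
    with eq[of n i] show ?thesis by algebra
  qed
  have zero: "S n = 0" for n
  proof -
    obtain a b c where n: "n = (a, b, c)" by (cases n)
    have const: "S (a + int k, b, c) = S n" for k
    proof (induction k)
      case (Suc k)
      then show ?case
        using step[of "(a + int k, b, c)" 1] by (simp add: w_simps ac_simps)
    qed (simp add: n)
    have "(\<lambda>k. S (a + int k, b, c)) \<longlonglongrightarrow> (\<Sum>j\<in>(UNIV::6 set). 0)"
      unfolding S_def using assms(2) by (intro tendsto_sum) (simp add: decaying_def)
    then show ?thesis
      by (simp add: const LIMSEQ_const_iff)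
  qed
  have "f (partner i n) = - f (site i n)" for i n
    using eq[of n i] unfolding zero add_0 by (simp only: add_eq_0_iff)
  with zero show ?thesis
    unfolding flow_def S_def by blast
qed

lemma decaying_if_finite_level_sets:
  assumes "\<And>e. e > 0 \<Longrightarrow> finite {v. cmod (f v) \<ge> e}"
  shows "decaying f"
  unfolding decaying_def
proof (intro allI)
  fix j a b c
  let ?s = "\<lambda>k. site j (a + int k, b, c)"
  have "inj ?s"
    by (auto simp: inj_def)
  then have "finite {k. cmod (f (?s k)) \<ge> e}" if "e > 0" for e
    using finite_vimageI[OF assms[OF that], of ?s] by (simp add: vimage_def)
  then have "\<forall>\<^sub>F k in cofinite. cmod (f (?s k)) < e" if "e > 0" for e
    using that by (simp add: eventually_cofinite not_less)
  then show "(\<lambda>k. f (?s k)) \<longlonglongrightarrow> 0"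
    by (simp add: tendsto_iff cofinite_eq_sequentially)
qed

section \<open>The Koszul resolution\<close>

lemma finsupp_imp_decaying:
  assumes "f \<in> finsupp"
  shows "decaying f"
proof (rule decaying_if_finite_level_sets)
  show "finite {v. cmod (f v) \<ge> e}" if "e > 0" for e
    using assms that by (auto simp: finsupp_def elim!: rev_finite_subset)
qed

text \<open>Only the cell \<open>- m\<close> contributes to the exponent \<open>m\<close>, because
  the transform negates exponents; finite support turns \<open>Sum_any\<close> into a finite
  sum.\<close>

lemma lookup_floquet:
  assumes "f \<in> finsupp"
  shows "Poly_Mapping.lookup (floquet f $ i) m = f (site i (- m))"
proof -
  let ?g = "\<lambda>n. Poly_Mapping.single (- n) (f (site i n))"
  have "floquet f $ i = Sum_any ?g"
    unfolding floquet_def site_def vec_lambda_beta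
    by (intro arg_cong[of _ _ Sum_any]) (simp add: fun_eq_iff)
  moreover have "finite {n. ?g n \<noteq> 0}"
  proof (rule finite_subset)
    show "{n. ?g n \<noteq> 0} \<subseteq> site i -` {v. f v \<noteq> 0}"
      by auto
    show "finite (site i -` {v. f v \<noteq> 0})"
      using assms by (intro finite_vimageI) (auto simp: finsupp_def inj_def)
  qed
  ultimately have "Poly_Mapping.lookup (floquet f $ i) m =
      (\<Sum>n | ?g n \<noteq> 0. f (site i n) when - n = m)"
    by (simp add: Sum_any.expand_set lookup_sum lookup_single)
  also have "\<dots> = (\<Sum>n | ?g n \<noteq> 0. if n = - m then f (site i n) else 0)"
    by (intro sum.cong) (auto simp: when_def)
  also have "\<dots> = f (site i (- m))"
    using \<open>finite {n. ?g n \<noteq> 0}\<close> by simp (metis lookup_single_eq lookup_zero)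
  finally show ?thesis .
qed

lemma lookup_single_mult:
  fixes h :: "'a::group_add \<Rightarrow>\<^sub>0 'b::semiring_1"
  shows "Poly_Mapping.lookup (Poly_Mapping.single k 1 * h) m = Poly_Mapping.lookup h (- k + m)"
proof -
  have "(1 when k = l) * (\<Sum>q. Poly_Mapping.lookup h q when m = l + q) =
      ((\<Sum>q. Poly_Mapping.lookup h q when m = l + q) when l = k)" for l
    by (simp add: when_def)
  moreover have "m = k + q \<longleftrightarrow> q = - k + m" for q
    by (metis add.assoc add.left_neutral left_minus right_minus)
  ultimately show ?thesis
    by (simp add: lookup_mult lookup_single)
qed

text \<open>Compare coefficients: the first condition is the zero sum over each octahedron. In the
  second, the monomial with exponent \<open>w $ i\<close> makes component \<open>i + 3\<close> be
  read in the cell shifted by \<open>w $ i\<close>, which gives the sign change along edges.\<close>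

lemma eigenmodule_eq:
  "eigenmodule (- 2) = {p. (\<Sum>i\<in>UNIV. p $ i) = 0 \<and>
     (\<forall>i. p $ i + Poly_Mapping.single (w $ i) 1 * p $ (i + 3) = 0)}" (is "_ = ?K")
proof (intro equalityI subsetI)
  fix p assume "p \<in> eigenmodule (- 2)"
  then obtain f where p: "p = floquet f" and f: "f \<in> finsupp" "adj_op f = (\<lambda>v. - 2 * f v)"
    unfolding eigenmodule_def by blast
  have "flow f"
    using f finsupp_imp_decaying eigenfunction_imp_flow by blast
  have "(\<Sum>i\<in>UNIV. p $ i) = 0"
    by (rule poly_mapping_eqI) (simp add: lookup_sum p lookup_floquet f(1) flow_sum[OF \<open>flow f\<close>])
  moreover have "p $ i + Poly_Mapping.single (w $ i) 1 * p $ (i + 3) = 0" for i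
  proof (rule poly_mapping_eqI)
    show "Poly_Mapping.lookup (p $ i + Poly_Mapping.single (w $ i) 1 * p $ (i + 3)) m =
        Poly_Mapping.lookup 0 m" for m
      using flow_partner[OF \<open>flow f\<close>, of i "- m"]
      by (simp add: lookup_add lookup_single_mult p lookup_floquet f(1) partner_def add.commute)
  qed
  ultimately show "p \<in> ?K"
    by simp
next
  fix p assume "p \<in> ?K"
  then have sum: "(\<Sum>i\<in>UNIV. p $ i) = 0"
    and opp: "p $ i + Poly_Mapping.single (w $ i) 1 * p $ (i + 3) = 0" for i
    by blast+
  define f where "f v = (if v \<in> V then
      (case inv (\<lambda>(i, n). site i n) v of (i, n) \<Rightarrow> Poly_Mapping.lookup (p $ i) (- n)) else 0)" for v
  have "inj (\<lambda>(i, n). site i n)"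
    by (auto simp: inj_def)
  then have f_site: "f (site i n) = Poly_Mapping.lookup (p $ i) (- n)" for i n
    using inv_f_f[of "\<lambda>(i, n). site i n" "(i, n)"] by (simp add: f_def)
  have supp: "{v. f v \<noteq> 0} \<subseteq> (\<Union>i\<in>UNIV. (\<lambda>k. site i (- k)) ` Poly_Mapping.keys (p $ i))"
  proof
    fix v assume v: "v \<in> {v. f v \<noteq> 0}"
    then have "v \<in> V"
      by (auto simp: f_def split: if_splits)
    then obtain i n where "v = site i n" by (rule V_cases)
    with v show "v \<in> (\<Union>i\<in>UNIV. (\<lambda>k. site i (- k)) ` Poly_Mapping.keys (p $ i))"
      by (auto simp: f_site in_keys_iff intro!: image_eqI[of _ _ "- n"])
  qed
  have "finite {v. f v \<noteq> 0}"
    by (rule finite_subset[OF supp]) simp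
  then have fin: "f \<in> finsupp"
    unfolding finsupp_def functions_on_V_def by (auto simp: f_def)
  have "(\<Sum>j\<in>UNIV. f (site j n)) = 0" for n
    using arg_cong[OF sum, of "\<lambda>q. Poly_Mapping.lookup q (- n)"] by (simp add: lookup_sum f_site)
  moreover have "f (partner i n) = - f (site i n)" for i n
    using arg_cong[OF opp[of i], of "\<lambda>q. Poly_Mapping.lookup q (- n)"]
    by (simp add: lookup_add lookup_single_mult f_site partner_def add_eq_0_iff algebra_simps)
  ultimately have "flow f"
    unfolding flow_def by blast
  then have "adj_op f = (\<lambda>v. - 2 * f v)"
    using fin by (intro flow_imp_eigenfunction) (simp_all add: finsupp_def)
  moreover have "p = floquet f"
    unfolding vec_eq_iff by (intro allI poly_mapping_eqI) (simp add: lookup_floquet fin f_site)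
  ultimately show "p \<in> eigenmodule (- 2)"
    unfolding eigenmodule_def using fin by blast
qed

section \<open>Substitutions into Laurent polynomials, as push-forwards along maps of
  exponents\<close>

definition collapse :: "('a \<Rightarrow> 'a) \<Rightarrow> ('a \<Rightarrow>\<^sub>0 'b) \<Rightarrow> 'a \<Rightarrow>\<^sub>0 'b::comm_monoid_add" where
  "collapse \<phi> h = (\<Sum>k\<in>Poly_Mapping.keys h. Poly_Mapping.single (\<phi> k) (Poly_Mapping.lookup h k))"

lemma collapse_eq_sum:
  assumes "finite A" "Poly_Mapping.keys h \<subseteq> A"
  shows "collapse \<phi> h = (\<Sum>k\<in>A. Poly_Mapping.single (\<phi> k) (Poly_Mapping.lookup h k))"
  unfolding collapse_def using assms by (intro sum.mono_neutral_left) (auto simp: in_keys_iff)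

lemma collapse_id: "collapse (\<lambda>k. k) h = h"
proof (rule poly_mapping_eqI)
  fix m
  have "Poly_Mapping.lookup (collapse (\<lambda>k. k) h) m =
      (\<Sum>k\<in>Poly_Mapping.keys h. if k = m then Poly_Mapping.lookup h m else 0)"
    unfolding collapse_def lookup_sum by (intro sum.cong) (auto simp: lookup_single when_def)
  then show "Poly_Mapping.lookup (collapse (\<lambda>k. k) h) m = Poly_Mapping.lookup h m"
    by (simp add: in_keys_iff)
qed

lemma collapse_single [simp]: "collapse \<phi> (Poly_Mapping.single k c) = Poly_Mapping.single (\<phi> k) c"
  by (subst collapse_eq_sum[of "{k}"]) (auto simp: in_keys_iff lookup_single when_def split: if_splits)

lemma collapse_one: "\<phi> 0 = 0 \<Longrightarrow> collapse \<phi> 1 = 1"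
  unfolding single_one[symmetric] collapse_single by simp

lemma collapse_zero [simp]: "collapse \<phi> 0 = 0"
  by (simp add: collapse_def)

lemma collapse_add: "collapse \<phi> (g + h) = collapse \<phi> g + collapse \<phi> h"
proof -
  let ?A = "Poly_Mapping.keys g \<union> Poly_Mapping.keys h"
  have "Poly_Mapping.keys (g + h) \<subseteq> ?A"
    by (rule keys_add)
  then show ?thesis
    by (simp add: collapse_eq_sum[of ?A] lookup_add single_add sum.distrib)
qed

lemma collapse_sum: "collapse \<phi> (sum g A) = (\<Sum>a\<in>A. collapse \<phi> (g a))"
  by (induction A rule: infinite_finite_induct) (simp_all add: collapse_add)

lemma collapse_uminus: "collapse \<phi> (- h) = - collapse \<phi> h"
  for h :: "'a \<Rightarrow>\<^sub>0 'b::ab_group_add"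
  using collapse_add[of \<phi> h "- h"] by (simp add: add_eq_0_iff)

lemma collapse_diff: "collapse \<phi> (g - h) = collapse \<phi> g - collapse \<phi> h"
  for g h :: "'a \<Rightarrow>\<^sub>0 'b::ab_group_add"
  using collapse_add[of \<phi> g "- h"] by (simp add: collapse_uminus)

text \<open>After both factors are expanded into monomials by \<open>collapse_id\<close>, only the
  additivity of \<open>\<phi>\<close> on exponents is left.\<close>

lemma collapse_mult:
  fixes g h :: "'a::comm_monoid_add \<Rightarrow>\<^sub>0 'b::comm_semiring_0"
  assumes "\<And>k l. \<phi> (k + l) = \<phi> k + \<phi> l"
  shows "collapse \<phi> (g * h) = collapse \<phi> g * collapse \<phi> h"
proof -
  have "collapse \<phi> (g * h) = collapse \<phi> (collapse (\<lambda>k. k) g * collapse (\<lambda>k. k) h)"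
    by (simp only: collapse_id)
  also have "\<dots> = collapse \<phi> g * collapse \<phi> h"
    unfolding collapse_def[of "\<lambda>k. k"]
    by (simp add: sum_product collapse_sum mult_single assms)
      (simp add: collapse_def sum_product mult_single)
  finally show ?thesis .
qed

lemma single_zero_one [simp]: "Poly_Mapping.single (0, 0, 0) 1 = (1 :: laurent)"
  unfolding single_one[symmetric] zero_prod_def ..

abbreviation at_x1 :: "laurent \<Rightarrow> laurent" where
  "at_x1 \<equiv> collapse (\<lambda>k. (0, snd k))"

abbreviation at_y1 :: "laurent \<Rightarrow> laurent" where
  "at_y1 \<equiv> collapse (\<lambda>k. (fst k, 0, snd (snd k)))"

lemma at_x1_simps [simp]: "at_x1 X = 1" "at_x1 Y = Y" "at_x1 Z = Z" "at_x1 1 = 1"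
  and at_y1_simps [simp]: "at_y1 Y = 1" "at_y1 Z = Z" "at_y1 1 = 1"
  by (simp_all add: X_def Y_def Z_def collapse_one zero_prod_def)

lemma at_x1_mult: "at_x1 (g * h) = at_x1 g * at_x1 h"
  and at_y1_mult: "at_y1 (g * h) = at_y1 g * at_y1 h"
  by (rule collapse_mult, simp)+

text \<open>Here \<open>u\<close> models the integer powers of a unit. Nonnegative exponents go by
  induction, negative ones by \<open>u k - 1 = - u k (u (- k) - 1)\<close>.\<close>

lemma one_minus_dvd_int_power:
  fixes u :: "int \<Rightarrow> 'a::comm_ring_1"
  assumes "u 0 = 1" "\<And>i j. u (i + j) = u i * u j"
  shows "1 - u 1 dvd u k - 1"
proof -
  have pos: "1 - u 1 dvd u (int n) - 1" for n
  proof (induction n)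
    case (Suc n)
    have "u (int (Suc n)) - 1 = u 1 * (u (int n) - 1) - (1 - u 1)"
      using assms(2)[of 1 "int n"] by (simp add: algebra_simps)
    then show ?case
      using dvd_diff[OF dvd_mult[OF Suc] dvd_refl] by (simp only:)
  qed (simp add: assms(1))
  show ?thesis
  proof (cases "k \<ge> 0")
    case True
    with pos[of "nat k"] show ?thesis by simp
  next
    case False
    have "u k * u (- k) = 1"
      using assms(2)[of k "- k"] assms(1) by simp
    then have "u k - 1 = - (u k * (u (- k) - 1))"
      by (simp add: algebra_simps)
    with False pos[of "nat (- k)"] show ?thesis by simp
  qed
qed

lemma dvd_diff_collapse:
  fixes h :: laurent
  assumes "\<And>k. d dvd Poly_Mapping.single k 1 - Poly_Mapping.single (\<phi> k) 1"
  shows "d dvd h - collapse \<phi> h"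
proof -
  have factor: "Poly_Mapping.single k c - Poly_Mapping.single (\<phi> k) c =
      Poly_Mapping.single 0 c * (Poly_Mapping.single k 1 - Poly_Mapping.single (\<phi> k) 1)"
    for k and c :: complex
    by (simp only: right_diff_distrib mult_single add_0_left mult_1_right)
  have single: "d dvd Poly_Mapping.single k c - Poly_Mapping.single (\<phi> k) c" for k c
    unfolding factor[of k c] by (rule dvd_mult[OF assms])
  have "collapse (\<lambda>k. k) h - collapse \<phi> h = (\<Sum>k\<in>Poly_Mapping.keys h.
      Poly_Mapping.single k (Poly_Mapping.lookup h k) - Poly_Mapping.single (\<phi> k) (Poly_Mapping.lookup h k))"
    by (simp only: collapse_def sum_subtractf)
  then have "d dvd collapse (\<lambda>k. k) h - collapse \<phi> h"
    by (simp only: dvd_sum single)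
  then show ?thesis
    by (simp only: collapse_id)
qed

text \<open>The factor theorem at \<open>x = 1\<close>: on a monomial the difference is
  \<open>y^b z^c (x^a - 1)\<close>.\<close>

lemma one_minus_X_dvd: "1 - X dvd h - at_x1 h"
proof (rule dvd_diff_collapse)
  show "1 - X dvd Poly_Mapping.single k 1 - Poly_Mapping.single (0, snd k) 1"
    for k
  proof (cases k)
    case (fields a b c)
    have "1 - X dvd Poly_Mapping.single (a, 0, 0) 1 - 1"
      unfolding X_def
      by (rule one_minus_dvd_int_power[of "\<lambda>i. Poly_Mapping.single (i, 0, 0) 1"])
        (simp_all add: mult_single)
    then have "1 - X dvd Poly_Mapping.single (0, b, c) 1 *
        (Poly_Mapping.single (a, 0, 0) 1 - 1)"
      by (rule dvd_mult)
    then show ?thesis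
      by (simp add: fields right_diff_distrib mult_single)
  qed
qed

lemma one_minus_Y_dvd: "1 - Y dvd h - at_y1 h"
proof (rule dvd_diff_collapse)
  show "1 - Y dvd Poly_Mapping.single k 1 - Poly_Mapping.single (fst k, 0, snd (snd k)) 1"
    for k
  proof (cases k)
    case (fields a b c)
    have "1 - Y dvd Poly_Mapping.single (0, b, 0) 1 - 1"
      unfolding Y_def
      by (rule one_minus_dvd_int_power[of "\<lambda>i. Poly_Mapping.single (0, i, 0) 1"])
        (simp_all add: mult_single)
    then have "1 - Y dvd Poly_Mapping.single (a, 0, c) 1 *
        (Poly_Mapping.single (0, b, 0) 1 - 1)"
      by (rule dvd_mult)
    then show ?thesis
      by (simp add: fields right_diff_distrib mult_single)
  qed
qed

text \<open>The equation makes the coefficients of \<open>h\<close> constant along every line in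
  direction \<open>e\<close>, so a nonzero one would contradict finite support.\<close>

lemma one_minus_monomial_mult_eq_0:
  fixes h :: laurent
  assumes "(1 - Poly_Mapping.single e 1) * h = 0" "e \<noteq> 0"
  shows "h = 0"
proof (rule ccontr)
  assume "h \<noteq> 0"
  then obtain k where "Poly_Mapping.lookup h k \<noteq> 0"
    by (metis lookup_zero poly_mapping_eqI)
  obtain x y z where e: "e = (x, y, z)" by (cases e)
  obtain a b c where k: "k = (a, b, c)" by (cases k)
  have shift: "Poly_Mapping.lookup h (m + e) = Poly_Mapping.lookup h m" for m
    using arg_cong[OF assms(1), of "\<lambda>q. Poly_Mapping.lookup q (m + e)"]
    by (simp add: left_diff_distrib lookup_minus lookup_single_mult)
  let ?s = "\<lambda>j. (a + int j * x, b + int j * y, c + int j * z)"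
  have "Poly_Mapping.lookup h (?s j) = Poly_Mapping.lookup h k" for j
  proof (induction j)
    case (Suc j)
    then show ?case
      using shift[of "?s j"] by (simp add: e algebra_simps)
  qed (simp add: k)
  then have "range ?s \<subseteq> Poly_Mapping.keys h"
    using \<open>Poly_Mapping.lookup h k \<noteq> 0\<close> by (auto simp: in_keys_iff)
  moreover have "inj ?s"
    using assms(2) by (auto simp: inj_def e zero_prod_def)
  ultimately show False
    by (meson finite_keys finite_subset range_inj_infinite)
qed

section \<open>Exactness of the Koszul complex of \<open>1 - x\<close>, \<open>1 - y\<close>,
  \<open>1 - z\<close>\<close>

lemma one_minus_X_cancel: "(1 - X) * h = 0 \<Longrightarrow> h = 0"
  and one_minus_Y_cancel: "(1 - Y) * h = 0 \<Longrightarrow> h = 0"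
  and one_minus_Z_cancel: "(1 - Z) * h = 0 \<Longrightarrow> h = 0"
  unfolding X_def Y_def Z_def
  by (erule one_minus_monomial_mult_eq_0; simp add: zero_prod_def)+

text \<open>Setting \<open>x = 1\<close> and then \<open>y = 1\<close> leaves \<open>1 - z\<close>
  times \<open>r(1, 1, z)\<close>, so \<open>1 - y\<close> divides \<open>r(1, y, z)\<close>. The
  quotient \<open>a\<close> determines \<open>q(1, y, z)\<close>, lifting back from
  \<open>x = 1\<close> introduces the two other coefficients, and cancelling \<open>1 - x\<close>
  yields \<open>p\<close>.\<close>

lemma koszul_exact_middle:
  assumes "(1 - X) * p + (1 - Y) * q + (1 - Z) * r = 0"
  obtains a b c where "p = (1 - Z) * b - (1 - Y) * c" "q = (1 - X) * c - (1 - Z) * a"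
    "r = (1 - Y) * a - (1 - X) * b"
proof -
  have *: "(1 - Y) * at_x1 q + (1 - Z) * at_x1 r = 0"
    using arg_cong[OF assms, of at_x1] by (simp add: collapse_add at_x1_mult collapse_diff)
  have "(1 - Z) * at_y1 (at_x1 r) = 0"
    using arg_cong[OF *, of at_y1] by (simp add: collapse_add at_y1_mult collapse_diff)
  then have "at_y1 (at_x1 r) = 0"
    by (rule one_minus_Z_cancel)
  then have "1 - Y dvd at_x1 r"
    using one_minus_Y_dvd[of "at_x1 r"] by (simp only: diff_zero)
  then obtain a where a: "at_x1 r = (1 - Y) * a" ..
  \<comment> \<open>This is the Koszul coefficient \<open>b\<close> up to sign.\<close>
  obtain b' where b: "r - at_x1 r = (1 - X) * b'" using one_minus_X_dvd ..
  have "(1 - Y) * (at_x1 q + (1 - Z) * a) = 0"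
    using * a by (simp add: algebra_simps)
  then have q: "at_x1 q = - ((1 - Z) * a)"
    by (simp only: one_minus_Y_cancel eq_neg_iff_add_eq_0)
  obtain c where c: "q - at_x1 q = (1 - X) * c" using one_minus_X_dvd ..
  have r_eq: "r = (1 - Y) * a + (1 - X) * b'"
    using diff_add_cancel[of r "at_x1 r", symmetric] unfolding b unfolding a
    by (simp only: add.commute)
  have q_eq: "q = (1 - X) * c - (1 - Z) * a"
    using diff_add_cancel[of q "at_x1 q", symmetric] unfolding c unfolding q
    by (simp only: add_uminus_conv_diff)
  have "(1 - X) * (p + (1 - Y) * c + (1 - Z) * b') = 0"
    using assms unfolding r_eq q_eq by (simp add: algebra_simps)
  then have "p + (1 - Y) * c + (1 - Z) * b' = 0"
    by (rule one_minus_X_cancel)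
  then have p_eq: "p = - ((1 - Y) * c + (1 - Z) * b')"
    by (simp only: eq_neg_iff_add_eq_0 add.assoc)
  show ?thesis
    by (rule that[of "- b'" c a]) (simp_all add: p_eq q_eq r_eq)
qed

text \<open>At \<open>x = 1\<close> the first relation becomes
  \<open>(1 - y) p(1, y, z) = 0\<close>, so \<open>1 - x\<close> divides \<open>p\<close>; the
  quotient serves for \<open>q\<close> and \<open>r\<close> too, after cancelling
  \<open>1 - x\<close>.\<close>

lemma koszul_exact_left:
  assumes "(1 - X) * q = (1 - Y) * p" "(1 - X) * r = (1 - Z) * p"
  obtains h where "p = h * (1 - X)" "q = h * (1 - Y)" "r = h * (1 - Z)"
proof -
  have "(1 - Y) * at_x1 p = 0"
    using arg_cong[OF assms(1), of at_x1, symmetric] by (simp add: at_x1_mult collapse_diff)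
  then have "at_x1 p = 0"
    by (rule one_minus_Y_cancel)
  then have "1 - X dvd p"
    using one_minus_X_dvd[of p] by (simp only: diff_zero)
  then obtain h where h: "p = (1 - X) * h" ..
  have cancel: "u = v * h" if "(1 - X) * u = v * ((1 - X) * h)" for u v
  proof -
    have "(1 - X) * (u - v * h) = 0"
      unfolding right_diff_distrib that by (simp only: mult.left_commute right_minus_eq)
    then have "u - v * h = 0"
      by (rule one_minus_X_cancel)
    then show ?thesis
      by (simp only: right_minus_eq)
  qed
  have "q = (1 - Y) * h" "r = (1 - Z) * h"
    by (intro cancel assms[unfolded h])+
  then show ?thesis
    using h by (intro that[of h]) (simp_all only: mult.commute)
qed

section \<open>The Koszul complex in terms of \<open>f1\<close>, \<open>f2\<close>,
  \<open>f3\<close>\<close>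

lemma second_map_nth:
  "second_map h $ 1 = h $ 2 * (X - X * Z) + h $ 3 * (- X + X * Y)"
  "second_map h $ 2 = h $ 1 * (- Y + Y * Z) + h $ 3 * (Y - X * Y)"
  "second_map h $ 3 = h $ 1 * (Z - Y * Z) + h $ 2 * (- Z + X * Z)"
  "second_map h $ 4 = h $ 2 * (- 1 + Z) + h $ 3 * (1 - Y)"
  "second_map h $ 5 = h $ 1 * (1 - Z) + h $ 3 * (- 1 + X)"
  "second_map h $ 6 = h $ 1 * (- 1 + Y) + h $ 2 * (1 - X)"
  by (simp_all add: second_map_def f1_def f2_def f3_def vector_6)

lemma single_w:
  "Poly_Mapping.single (w $ 1) 1 = X" "Poly_Mapping.single (w $ 2) 1 = Y"
  "Poly_Mapping.single (w $ 3) 1 = Z" "Poly_Mapping.single (w $ 4) 1 * X = 1"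
  "Poly_Mapping.single (w $ 5) 1 * Y = 1" "Poly_Mapping.single (w $ 6) 1 * Z = 1"
  by (simp_all add: w_simps X_def Y_def Z_def mult_single)

text \<open>The sign conditions express components 1 to 3 through components 4 to 6; after this
  elimination the zero sum is the Koszul relation for the latter.\<close>

lemma eigenmodule_iff:
  "p \<in> eigenmodule (- 2) \<longleftrightarrow> p $ 1 = - (X * p $ 4) \<and> p $ 2 = - (Y * p $ 5) \<and> p $ 3 = - (Z * p $ 6) \<and>
     (1 - X) * p $ 4 + (1 - Y) * p $ 5 + (1 - Z) * p $ 6 = 0"
proof -
  \<comment> \<open>The sign condition at \<open>i + 3\<close> is the one at \<open>i\<close> times
    an invertible monomial.\<close>
  have inverse: "q + u * p' = 0" if "u * v = 1" "p' + v * q = 0" for q p' u v :: laurent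
  proof -
    have "q + u * p' = u * (p' + v * q) + (1 - u * v) * q"
      by (simp add: algebra_simps)
    then show ?thesis
      by (simp only: that) simp
  qed
  have opposite: "(\<forall>i. p $ i + Poly_Mapping.single (w $ i) 1 * p $ (i + 3) = 0) \<longleftrightarrow>
      p $ 1 + X * p $ 4 = 0 \<and> p $ 2 + Y * p $ 5 = 0 \<and> p $ 3 + Z * p $ 6 = 0"
    (is "(\<forall>i. ?P i) \<longleftrightarrow> ?R")
  proof
    assume P: "\<forall>i. ?P i"
    show ?R
      using P[rule_format, of 1] P[rule_format, of 2] P[rule_format, of 3] by (simp add: single_w)
  next
    assume R: ?R
    then have "?P 1" "?P 2" "?P 3"
      by (simp_all add: single_w)
    moreover have "?P 4" "?P 5" "?P 6"
      using R by (simp_all add: numeral_mod_6 inverse[OF single_w(4)] inverse[OF single_w(5)]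
        inverse[OF single_w(6)])
    ultimately show "\<forall>i. ?P i"
      unfolding forall_6 by blast
  qed
  have sum: "(\<Sum>i\<in>UNIV. p $ i) = (p $ 1 + X * p $ 4) + (p $ 2 + Y * p $ 5) + (p $ 3 + Z * p $ 6)
      + ((1 - X) * p $ 4 + (1 - Y) * p $ 5 + (1 - Z) * p $ 6)"
    unfolding sum_6 by (simp add: algebra_simps)
  show ?thesis
    unfolding eigenmodule_eq mem_Collect_eq opposite eq_neg_iff_add_eq_0 sum
    by (metis add_0)
qed

lemma range_second_map: "range second_map = eigenmodule (- 2)"
proof (intro equalityI subsetI)
  show "p \<in> eigenmodule (- 2)" if "p \<in> range second_map" for p
    using that by (auto simp: eigenmodule_iff second_map_nth algebra_simps)
next
  fix p assume "p \<in> eigenmodule (- 2)"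
  then have p: "p $ 1 = - (X * p $ 4)" "p $ 2 = - (Y * p $ 5)" "p $ 3 = - (Z * p $ 6)"
    and "(1 - X) * p $ 4 + (1 - Y) * p $ 5 + (1 - Z) * p $ 6 = 0"
    by (simp_all add: eigenmodule_iff)
  from this(4) obtain a b c where abc: "p $ 4 = (1 - Z) * b - (1 - Y) * c"
    "p $ 5 = (1 - X) * c - (1 - Z) * a" "p $ 6 = (1 - Y) * a - (1 - X) * b"
    by (rule koszul_exact_middle)
  \<comment> \<open>On components 4 to 6 \<open>second_map\<close> is the negative of the Koszul
    map, whence the signs.\<close>
  have "second_map (vector [- a, - b, - c]) = p"
    unfolding vec_eq_iff forall_6 second_map_nth vector_3 p abc by (simp add: algebra_simps)
  then show "p \<in> range second_map"
    by blast
qed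

lemma second_map_kernel: "second_map h = 0 \<longleftrightarrow> h \<in> range first_map"
proof
  assume "second_map h = 0"
  then have zero: "second_map h $ i = 0" for i
    by simp
  \<comment> \<open>Components 6 and 5 of the image are the two relations from which
    \<open>koszul_exact_left\<close> extracts a common multiplier.\<close>
  have "(1 - X) * h $ 2 - (1 - Y) * h $ 1 = second_map h $ 6"
    "(1 - Z) * h $ 1 - (1 - X) * h $ 3 = second_map h $ 5"
    by (simp_all add: second_map_nth algebra_simps)
  then have "(1 - X) * h $ 2 = (1 - Y) * h $ 1" "(1 - X) * h $ 3 = (1 - Z) * h $ 1"
    unfolding zero right_minus_eq by simp_all
  then obtain g where "h $ 1 = g * (1 - X)" "h $ 2 = g * (1 - Y)" "h $ 3 = g * (1 - Z)"
    by (rule koszul_exact_left)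
  then have "h = first_map g"
    by (simp add: vec_eq_iff forall_3 first_map_def)
  then show "h \<in> range first_map"
    by blast
next
  assume "h \<in> range first_map"
  then show "second_map h = 0"
    by (auto simp: vec_eq_iff forall_6 second_map_nth first_map_def algebra_simps)
qed

lemma inj_first_map: "inj first_map"
proof (rule injI)
  fix g h assume eq: "first_map g = first_map h"
  have "(1 - X) * (g - h) = first_map g $ 1 - first_map h $ 1"
    by (simp add: first_map_def algebra_simps)
  also have "\<dots> = 0"
    by (simp only: eq diff_self)
  finally have "g - h = 0"
    by (rule one_minus_X_cancel)
  then show "g = h"
    by simp
qed

section \<open>Module homomorphisms and spans\<close>

lemma module_vec: "module ((*s) :: 'a::comm_ring_1 \<Rightarrow> 'a ^ 'n \<Rightarrow> 'a ^ 'n)"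
  by unfold_locales (simp_all add: vec_eq_iff algebra_simps)

lemma module_self: "module ((*) :: 'a::comm_ring_1 \<Rightarrow> 'a \<Rightarrow> 'a)"
  by unfold_locales (simp_all add: algebra_simps)

lemma module_hom_first_map: "module_hom (*) (*s) first_map"
  unfolding module_hom_iff
  by (simp add: module_vec module_self vec_eq_iff forall_3 first_map_def algebra_simps)

lemma module_hom_second_map: "module_hom (*s) (*s) second_map"
  unfolding module_hom_iff
  by (simp add: module_vec vec_eq_iff forall_6 second_map_nth algebra_simps)

lemma span_f: "module.span (*s) {f1, f2, f3} = range second_map"
proof -
  have "p \<in> module.span (*s) {f1, f2, f3} \<longleftrightarrow> (\<exists>a b c. p = a *s f1 + b *s f2 + c *s f3)" for p
    by (simp add: module.span_breakdown_eq[OF module_vec] module.span_empty[OF module_vec] algebra_simps)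
  moreover have "p \<in> range second_map \<longleftrightarrow> (\<exists>a b c. p = a *s f1 + b *s f2 + c *s f3)" for p
  proof
    assume "\<exists>a b c. p = a *s f1 + b *s f2 + c *s f3"
    then obtain a b c where "p = second_map (vector [a, b, c])"
      by (auto simp: second_map_def)
    then show "p \<in> range second_map" by blast
  qed (auto simp: second_map_def)
  ultimately show ?thesis
    by blast
qed

lemma span_syzygy: "module.span (*s) {vector [1 - X, 1 - Y, 1 - Z]} = range first_map"
  unfolding module.span_singleton[OF module_vec]
  by (intro arg_cong[where f = range] ext) (simp add: vec_eq_iff forall_3 first_map_def)

section \<open>Orthogonal projections in \<open>\<ell>\<^sup>2(V)\<close>\<close>

lemma summable_on_mult_cnj:
  assumes "f \<in> ell2" "g \<in> ell2"
  shows "(\<lambda>v. f v * cnj (g v)) summable_on V"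
proof (rule abs_summable_summable, rule abs_summable_product)
  show "(\<lambda>v. norm (f v * f v)) summable_on V"
    "(\<lambda>v. norm (cnj (g v) * cnj (g v))) summable_on V"
    using assms by (simp_all add: ell2_def norm_mult power2_eq_square)
qed

lemma ell2I:
  assumes "\<And>v. v \<notin> V \<Longrightarrow> f v = 0" "(\<lambda>v. f v * cnj (f v)) summable_on V"
  shows "f \<in> ell2"
  using summable_on_Re[OF assms(2)] assms(1)
  by (simp add: ell2_def functions_on_V_def complex_mult_cnj cmod_power2)

lemma ell2_outside: "f \<in> ell2 \<Longrightarrow> v \<notin> V \<Longrightarrow> f v = 0"
  unfolding ell2_def functions_on_V_def by blast

lemma ell2_zero: "(\<lambda>_. 0) \<in> ell2"
  by (rule ell2I) simp_all

lemma ell2_scale: "f \<in> ell2 \<Longrightarrow> (\<lambda>v. c * f v) \<in> ell2"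
proof (rule ell2I)
  assume f: "f \<in> ell2"
  have "(\<lambda>v. (c * cnj c) * (f v * cnj (f v))) summable_on V"
    by (intro summable_on_cmult_right summable_on_mult_cnj f)
  then show "(\<lambda>v. c * f v * cnj (c * f v)) summable_on V"
    by (simp add: mult_ac)
qed (simp add: ell2_outside)

lemma ell2_add:
  assumes "f \<in> ell2" "g \<in> ell2"
  shows "(\<lambda>v. f v + g v) \<in> ell2"
proof (rule ell2I)
  have "(\<lambda>v. (f v * cnj (f v) + f v * cnj (g v)) + (g v * cnj (f v) + g v * cnj (g v))) summable_on V"
    by (intro summable_on_add summable_on_mult_cnj assms)
  then show "(\<lambda>v. (f v + g v) * cnj (f v + g v)) summable_on V"
    by (simp add: algebra_simps)
qed (simp add: assms ell2_outside)

lemma ell2_diff: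
  assumes "f \<in> ell2" "g \<in> ell2"
  shows "(\<lambda>v. f v - g v) \<in> ell2"
  using ell2_add[OF assms(1) ell2_scale[OF assms(2), of "- 1"]] by simp

lemma ell2_inner_commute: "ell2_inner g f = cnj (ell2_inner f g)"
  unfolding ell2_inner_def by (simp add: mult.commute flip: infsum_cnj)

lemma ell2_inner_add_left:
  assumes "f \<in> ell2" "g \<in> ell2" "h \<in> ell2"
  shows "ell2_inner (\<lambda>v. f v + g v) h = ell2_inner f h + ell2_inner g h"
  unfolding ell2_inner_def distrib_right by (intro infsum_add summable_on_mult_cnj assms)

lemma ell2_inner_scale_left: "ell2_inner (\<lambda>v. c * f v) g = c * ell2_inner f g"
  unfolding ell2_inner_def mult.assoc by (rule infsum_cmult_right')

lemma ell2_inner_diff_left: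
  assumes "f \<in> ell2" "g \<in> ell2" "h \<in> ell2"
  shows "ell2_inner (\<lambda>v. f v - g v) h = ell2_inner f h - ell2_inner g h"
  using ell2_inner_add_left[OF assms(1) ell2_scale[OF assms(2), of "- 1"] assms(3)]
    ell2_inner_scale_left[of "- 1" g h] by simp

lemma ell2_inner_add_right:
  assumes "f \<in> ell2" "g \<in> ell2" "h \<in> ell2"
  shows "ell2_inner h (\<lambda>v. f v + g v) = ell2_inner h f + ell2_inner h g"
  using ell2_inner_add_left[OF assms] by (simp add: ell2_inner_commute[of h])

lemma ell2_inner_scale_right: "ell2_inner f (\<lambda>v. c * g v) = cnj c * ell2_inner f g"
  using ell2_inner_scale_left[of c g f] by (simp add: ell2_inner_commute[of f])

lemma ell2_inner_diff_right:
  assumes "f \<in> ell2" "g \<in> ell2" "h \<in> ell2"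
  shows "ell2_inner h (\<lambda>v. f v - g v) = ell2_inner h f - ell2_inner h g"
  using ell2_inner_diff_left[OF assms] by (simp add: ell2_inner_commute[of h])

section \<open>The squared norm and pointwise limits\<close>

definition sqnorm :: "(point \<Rightarrow> complex) \<Rightarrow> real" where
  "sqnorm f = (\<Sum>\<^sub>\<infinity>v\<in>V. (cmod (f v))\<^sup>2)"

lemma sqnorm_nonneg: "sqnorm f \<ge> 0"
  unfolding sqnorm_def by (intro infsum_nonneg) simp

lemma ell2_inner_self:
  assumes "f \<in> ell2"
  shows "ell2_inner f f = of_real (sqnorm f)"
proof -
  have "((\<lambda>v. (cmod (f v))\<^sup>2) has_sum sqnorm f) V"
    using assms unfolding sqnorm_def ell2_def by (simp add: summable_iff_has_sum_infsum)
  then have "((\<lambda>v. complex_of_real ((cmod (f v))\<^sup>2)) has_sum of_real (sqnorm f)) V"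
    by (rule has_sum_of_real)
  then show ?thesis
    unfolding ell2_inner_def complex_norm_square by (rule infsumI)
qed

lemma cmod_square_le_sqnorm:
  assumes "f \<in> ell2"
  shows "(cmod (f v))\<^sup>2 \<le> sqnorm f"
proof (cases "v \<in> V")
  case True
  then have "sum (\<lambda>v. (cmod (f v))\<^sup>2) {v} \<le> sqnorm f"
    using assms unfolding sqnorm_def ell2_def by (intro finite_sum_le_infsum) simp_all
  then show ?thesis by simp
qed (simp add: assms ell2_outside sqnorm_nonneg)

text \<open>The cases \<open>c = 1\<close> and \<open>c = - 1\<close> give the parallelogram law;
  small multiples drive the variational argument for orthogonality.\<close>

lemma sqnorm_diff_scale:
  assumes "f \<in> ell2" "g \<in> ell2"
  shows "sqnorm (\<lambda>v. f v - c * g v) =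
    sqnorm f - 2 * Re (cnj c * ell2_inner f g) + (cmod c)\<^sup>2 * sqnorm g"
proof -
  note cg = ell2_scale[OF assms(2), of c]
  have "complex_of_real (sqnorm (\<lambda>v. f v - c * g v)) =
      ell2_inner (\<lambda>v. f v - c * g v) (\<lambda>v. f v - c * g v)"
    by (simp add: ell2_inner_self ell2_diff assms cg)
  also have "\<dots> = of_real (sqnorm f) - (cnj c * ell2_inner f g + cnj (cnj c * ell2_inner f g))
      + (c * cnj c) * of_real (sqnorm g)"
    using ell2_inner_commute[of g f]
    by (simp add: ell2_inner_diff_left ell2_inner_diff_right ell2_inner_scale_left
      ell2_inner_scale_right ell2_diff assms cg ell2_inner_self algebra_simps)
  also have "\<dots> = of_real (sqnorm f - 2 * Re (cnj c * ell2_inner f g) + (cmod c)\<^sup>2 * sqnorm g)"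
    unfolding complex_add_cnj complex_norm_square[symmetric] by simp
  finally show ?thesis
    by (simp only: of_real_eq_iff)
qed

lemma sqnorm_parallelogram:
  assumes "f \<in> ell2" "g \<in> ell2"
  shows "sqnorm (\<lambda>v. f v - g v) + sqnorm (\<lambda>v. f v + g v) = 2 * sqnorm f + 2 * sqnorm g"
  using sqnorm_diff_scale[OF assms, of 1] sqnorm_diff_scale[OF assms, of "- 1"] by simp

lemma sqnorm_scale: "f \<in> ell2 \<Longrightarrow> sqnorm (\<lambda>v. c * f v) = (cmod c)\<^sup>2 * sqnorm f"
  unfolding sqnorm_def norm_mult power_mult_distrib by (rule infsum_cmult_right')

lemma sqnorm_eq_0_imp:
  assumes "f \<in> ell2" "sqnorm f = 0"
  shows "f v = 0"
  using cmod_square_le_sqnorm[OF assms(1), of v] assms(2) by simp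

text \<open>Fatou's lemma for sums: the bound passes to the limit over each finite set, and the
  finite partial sums control both membership and norm.\<close>

lemma ell2_pointwise_limit:
  assumes ell2: "\<And>n. s n \<in> ell2" and lim: "\<And>v. (\<lambda>n. s n v) \<longlonglongrightarrow> g v"
    and bound: "\<And>n. sqnorm (s n) \<le> B n" "B \<longlonglongrightarrow> b"
  shows "g \<in> ell2" "sqnorm g \<le> b"
proof -
  have le: "(\<Sum>v\<in>F. (cmod (g v))\<^sup>2) \<le> b" if "finite F" "F \<subseteq> V" for F
  proof (rule LIMSEQ_le)
    show "(\<lambda>n. \<Sum>v\<in>F. (cmod (s n v))\<^sup>2) \<longlonglongrightarrow> (\<Sum>v\<in>F. (cmod (g v))\<^sup>2)"
      by (intro tendsto_intros lim)
    have "(\<Sum>v\<in>F. (cmod (s n v))\<^sup>2) \<le> B n" for n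
    proof -
      have "(\<Sum>v\<in>F. (cmod (s n v))\<^sup>2) \<le> sqnorm (s n)"
        unfolding sqnorm_def using ell2[of n] that
        by (intro finite_sum_le_infsum) (simp_all add: ell2_def)
      with bound(1)[of n] show ?thesis by linarith
    qed
    then show "\<exists>N. \<forall>n\<ge>N. (\<Sum>v\<in>F. (cmod (s n v))\<^sup>2) \<le> B n"
      by blast
  qed (fact bound(2))
  have summable: "(\<lambda>v. (cmod (g v))\<^sup>2) summable_on V"
    by (rule nonneg_bdd_above_summable_on) (auto intro!: bdd_aboveI[of _ b] le)
  have "g v = 0" if "v \<notin> V" for v
    using lim[of v] that ell2 by (simp add: ell2_outside LIMSEQ_const_iff)
  with summable show "g \<in> ell2"
    unfolding ell2_def functions_on_V_def by blast
  show "sqnorm g \<le> b"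
    unfolding sqnorm_def using summable le by (rule infsum_le_finite_sums)
qed

text \<open>Closedness is asked for pointwise limits that stay in \<open>ell2\<close>. This includes
  limits in norm, and it suits the eigenspace, each of whose equations involves finitely many
  vertices.\<close>

locale ell2_closed_subspace =
  fixes S :: "(point \<Rightarrow> complex) set"
  assumes subset_ell2: "S \<subseteq> ell2"
    and zero: "(\<lambda>_. 0) \<in> S"
    and add: "f \<in> S \<Longrightarrow> g \<in> S \<Longrightarrow> (\<lambda>v. f v + g v) \<in> S"
    and scale: "f \<in> S \<Longrightarrow> (\<lambda>v. c * f v) \<in> S"
    and limit: "(\<And>n. s n \<in> S) \<Longrightarrow> (\<And>v. (\<lambda>n. s n v) \<longlonglongrightarrow> g v) \<Longrightarrow> g \<in> ell2 \<Longrightarrow> g \<in> S"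
begin

lemma diff: "f \<in> S \<Longrightarrow> g \<in> S \<Longrightarrow> (\<lambda>v. f v - g v) \<in> S"
  using add[of f "\<lambda>v. - 1 * g v"] scale[of g "- 1"] by simp

text \<open>A minimising sequence is Cauchy by the parallelogram law, hence converges pointwise, and
  the Fatou bound shows that the limit attains the infimum.\<close>

lemma nearest_point:
  assumes x: "x \<in> ell2"
  obtains g where "g \<in> S" "\<And>h. h \<in> S \<Longrightarrow> sqnorm (\<lambda>v. x v - g v) \<le> sqnorm (\<lambda>v. x v - h v)"
proof -
  define D where "D = (\<lambda>h. sqnorm (\<lambda>v. x v - h v)) ` S"
  define d where "d = Inf D"
  have "bdd_below D" "D \<noteq> {}"
    unfolding D_def using zero by (auto intro!: bdd_belowI[of _ 0] sqnorm_nonneg)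
  then have d_le: "d \<le> sqnorm (\<lambda>v. x v - h v)" if "h \<in> S" for h
    unfolding d_def using that by (intro cInf_lower) (auto simp: D_def)
  have "\<exists>h\<in>S. sqnorm (\<lambda>v. x v - h v) < d + 1 / real (Suc n)" for n
  proof -
    have "Inf D < d + 1 / real (Suc n)"
      unfolding d_def by simp
    from cInf_lessD[OF \<open>D \<noteq> {}\<close> this] show ?thesis
      unfolding D_def by blast
  qed
  then obtain s where s: "\<And>n. s n \<in> S" "\<And>n. sqnorm (\<lambda>v. x v - s n v) < d + 1 / real (Suc n)"
    by metis
  have s_ell2: "s n \<in> ell2" and xs: "(\<lambda>v. x v - s n v) \<in> ell2" for n
    using s(1) subset_ell2 x by (auto intro: ell2_diff)
  \<comment> \<open>The midpoint of \<open>s m\<close> and \<open>s n\<close> lies in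
    \<open>S\<close>, so its squared distance to \<open>x\<close> is at least \<open>d\<close>; the
    parallelogram law then leaves only the two error terms.\<close>
  have close: "sqnorm (\<lambda>v. s m v - s n v) \<le> 2 / real (Suc m) + 2 / real (Suc n)" for m n
  proof -
    have mid_S: "(\<lambda>v. 1 / 2 * (s n v + s m v)) \<in> S"
      using scale[OF add[OF s(1)[of n] s(1)[of m]], of "1 / 2"] .
    then have "4 * d \<le> 4 * sqnorm (\<lambda>v. x v - 1 / 2 * (s n v + s m v))"
      by (intro mult_left_mono d_le) simp_all
    also have "\<dots> = sqnorm (\<lambda>v. 2 * (x v - 1 / 2 * (s n v + s m v)))"
      using mid_S subset_ell2 by (subst sqnorm_scale[OF ell2_diff[OF x]]) auto
    also have "(\<lambda>v. 2 * (x v - 1 / 2 * (s n v + s m v))) = (\<lambda>v. (x v - s n v) + (x v - s m v))"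
      by (intro ext) (simp add: add_divide_distrib)
    finally have mid: "4 * d \<le> sqnorm (\<lambda>v. (x v - s n v) + (x v - s m v))" .
    have "(\<lambda>v. (x v - s n v) - (x v - s m v)) = (\<lambda>v. s m v - s n v)"
      by simp
    with sqnorm_parallelogram[OF xs[of n] xs[of m]]
    have "sqnorm (\<lambda>v. s m v - s n v) + sqnorm (\<lambda>v. (x v - s n v) + (x v - s m v)) =
        2 * sqnorm (\<lambda>v. x v - s n v) + 2 * sqnorm (\<lambda>v. x v - s m v)"
      by (simp only:)
    with mid s(2)[of n] s(2)[of m] show ?thesis
      by argo
  qed
  have "Cauchy (\<lambda>n. s n v)" for v
  proof (rule metric_CauchyI)
    fix e :: real assume "e > 0"
    \<comment> \<open>Two errors, each below \<open>2 * e^2 / 4\<close>, add up to less than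
      \<open>e^2\<close>.\<close>
    obtain N where N: "inverse (real (Suc N)) < e\<^sup>2 / 4"
      using reals_Archimedean[of "e\<^sup>2 / 4"] \<open>e > 0\<close> by auto
    have "dist (s m v) (s n v) < e" if "m \<ge> N" "n \<ge> N" for m n
    proof -
      have "inverse (real (Suc m)) \<le> inverse (real (Suc N))" "inverse (real (Suc n)) \<le> inverse (real (Suc N))"
        using that by (simp_all add: le_imp_inverse_le)
      moreover have "(cmod (s m v - s n v))\<^sup>2 \<le> 2 * inverse (real (Suc m)) + 2 * inverse (real (Suc n))"
        using cmod_square_le_sqnorm[OF ell2_diff[OF s_ell2[of m] s_ell2[of n]], of v] close[of m n]
        by (simp add: divide_inverse)
      ultimately have "(cmod (s m v - s n v))\<^sup>2 < e\<^sup>2"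
        using N by linarith
      then show ?thesis
        using \<open>e > 0\<close> by (simp add: dist_norm power_less_imp_less_base)
    qed
    then show "\<exists>M. \<forall>m\<ge>M. \<forall>n\<ge>M. dist (s m v) (s n v) < e"
      by blast
  qed
  then have "\<exists>l. (\<lambda>n. s n v) \<longlonglongrightarrow> l" for v
    using Cauchy_convergent convergent_def by blast
  then obtain g where g: "\<And>v. (\<lambda>n. s n v) \<longlonglongrightarrow> g v"
    by metis
  have lim: "(\<lambda>n. d + 1 / real (Suc n)) \<longlonglongrightarrow> d"
    using tendsto_add[OF tendsto_const LIMSEQ_inverse_real_of_nat, of d] by (simp add: inverse_eq_divide)
  have xg_lim: "(\<lambda>n. x v - s n v) \<longlonglongrightarrow> x v - g v" for v
    by (intro tendsto_intros g)
  note xg = ell2_pointwise_limit[of "\<lambda>n v. x v - s n v", OF xs xg_lim less_imp_le[OF s(2)] lim]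
  have "g \<in> ell2"
    using ell2_diff[OF x xg(1)] by simp
  then have "g \<in> S"
    using limit s(1) g by blast
  then show ?thesis
  proof (rule that)
    show "sqnorm (\<lambda>v. x v - g v) \<le> sqnorm (\<lambda>v. x v - h v)" if "h \<in> S" for h
      using xg(2) d_le[OF that] by (rule order_trans)
  qed
qed

text \<open>Moving the nearest point \<open>g\<close> by a multiple of \<open>h\<close> cannot
  decrease the distance to \<open>x\<close>, which forces the inner product to vanish.\<close>

lemma orthogonal_decomposition:
  assumes x: "x \<in> ell2"
  obtains g where "g \<in> S" "\<And>h. h \<in> S \<Longrightarrow> ell2_inner (\<lambda>v. x v - g v) h = 0"
proof -
  obtain g where g: "g \<in> S" "\<And>h. h \<in> S \<Longrightarrow> sqnorm (\<lambda>v. x v - g v) \<le> sqnorm (\<lambda>v. x v - h v)"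
    using nearest_point[OF x] by blast
  have "ell2_inner (\<lambda>v. x v - g v) h = 0" if h: "h \<in> S" for h
  proof -
    define y where "y = (\<lambda>v. x v - g v)"
    define p where "p = ell2_inner y h"
    \<comment> \<open>Chosen so that \<open>t * sqnorm h\<close> is at most 1; the added 1 keeps the
      denominator positive when \<open>h\<close> is zero.\<close>
    define t where "t = 1 / (sqnorm h + 1)"
    have y: "y \<in> ell2" and h': "h \<in> ell2"
      using g(1) h x subset_ell2 unfolding y_def by (auto intro: ell2_diff)
    have t: "t > 0" "t * sqnorm h \<le> 1"
      using sqnorm_nonneg[of h] by (simp_all add: t_def field_simps)
    have "(\<lambda>v. g v + (of_real t * p) * h v) \<in> S"
      by (intro add scale g(1) h)
    from g(2)[OF this] have "sqnorm y \<le> sqnorm (\<lambda>v. y v - (of_real t * p) * h v)"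
      by (simp add: y_def algebra_simps)
    also have "\<dots> = sqnorm y - 2 * Re (cnj (of_real t * p) * p) + (cmod (of_real t * p))\<^sup>2 * sqnorm h"
      unfolding p_def by (rule sqnorm_diff_scale[OF y h'])
    also have "cnj (of_real t * p) * p = of_real (t * (cmod p)\<^sup>2)"
      unfolding of_real_mult complex_norm_square by (simp add: mult_ac)
    also have "(cmod (of_real t * p))\<^sup>2 = t * t * (cmod p)\<^sup>2"
      by (simp add: norm_mult power2_eq_square)
    finally have "2 * (t * (cmod p)\<^sup>2) \<le> (t * (cmod p)\<^sup>2) * (t * sqnorm h)"
      by (simp add: mult_ac)
    also have "\<dots> \<le> (t * (cmod p)\<^sup>2) * 1"
      using t by (intro mult_left_mono) simp_all
    finally have "t * (cmod p)\<^sup>2 \<le> 0"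
      by simp
    with t(1) have "p = 0"
      by (simp add: mult_le_0_iff)
    then show ?thesis
      unfolding p_def y_def .
  qed
  with g(1) show ?thesis
    using that by blast
qed

text \<open>Two candidates differ by an element of \<open>S\<close> that is orthogonal to itself, so
  the description by \<open>THE\<close> is unambiguous.\<close>

lemma orth_proj_eqI:
  assumes x: "x \<in> ell2" and g: "g \<in> S" "\<And>h. h \<in> S \<Longrightarrow> ell2_inner (\<lambda>v. x v - g v) h = 0"
  shows "orth_proj S x = g"
  unfolding orth_proj_def
proof (rule the_equality)
  fix g' assume g': "g' \<in> S \<and> (\<forall>h\<in>S. ell2_inner (\<lambda>v. x v - g' v) h = 0)"
  let ?h = "\<lambda>v. g' v - g v"
  have h: "?h \<in> S"
    using g(1) g' by (intro diff) simp_all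
  have in_ell2: "g \<in> ell2" "g' \<in> ell2" "?h \<in> ell2"
    using g(1) g' h subset_ell2 by auto
  have "(\<lambda>v. (x v - g v) - (x v - g' v)) = ?h"
    by simp
  then have "ell2_inner ?h ?h = ell2_inner (\<lambda>v. x v - g v) ?h - ell2_inner (\<lambda>v. x v - g' v) ?h"
    using ell2_inner_diff_left[of "\<lambda>v. x v - g v" "\<lambda>v. x v - g' v" ?h] x in_ell2
    by (simp add: ell2_diff)
  also have "\<dots> = 0"
    using g(2)[OF h] g' h by simp
  finally have "sqnorm ?h = 0"
    using in_ell2(3) by (simp add: ell2_inner_self)
  then show "g' = g"
    using sqnorm_eq_0_imp[OF in_ell2(3)] by (intro ext) simp
qed (use g in blast)

lemma orth_proj:
  assumes "x \<in> ell2"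
  shows orth_proj_mem: "orth_proj S x \<in> S"
    and orth_proj_orthogonal: "h \<in> S \<Longrightarrow> ell2_inner (\<lambda>v. x v - orth_proj S x v) h = 0"
proof -
  obtain g where g: "g \<in> S" "\<And>h. h \<in> S \<Longrightarrow> ell2_inner (\<lambda>v. x v - g v) h = 0"
    using orthogonal_decomposition[OF assms] by blast
  with orth_proj_eqI[OF assms g] show "orth_proj S x \<in> S"
    and "h \<in> S \<Longrightarrow> ell2_inner (\<lambda>v. x v - orth_proj S x v) h = 0"
    by simp_all
qed

end

section \<open>The density of states\<close>

text \<open>By Chebyshev's inequality at most \<open>sqnorm f / e^2\<close> vertices carry a value
  of modulus at least \<open>e\<close>.\<close>

lemma ell2_decaying:
  assumes "f \<in> ell2"
  shows "decaying f"
proof (rule decaying_if_finite_level_sets)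
  fix e :: real assume e: "e > 0"
  have "finite {v \<in> V. e\<^sup>2 \<le> (cmod (f v))\<^sup>2}"
  proof (rule ccontr)
    assume inf: "infinite {v \<in> V. e\<^sup>2 \<le> (cmod (f v))\<^sup>2}"
    obtain m where m: "sqnorm f < real m * e\<^sup>2"
      using reals_Archimedean3[of "e\<^sup>2"] e by auto
    obtain F where F: "F \<subseteq> {v \<in> V. e\<^sup>2 \<le> (cmod (f v))\<^sup>2}" "finite F" "card F = m"
      using infinite_arbitrarily_large[OF inf] by blast
    have "real m * e\<^sup>2 \<le> (\<Sum>v\<in>F. (cmod (f v))\<^sup>2)"
      using F sum_bounded_below[of F "e\<^sup>2" "\<lambda>v. (cmod (f v))\<^sup>2"] by auto
    also have "\<dots> \<le> sqnorm f"
      unfolding sqnorm_def using F assms by (intro finite_sum_le_infsum) (auto simp: ell2_def)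
    finally show False
      using m by simp
  qed
  moreover have "{v. cmod (f v) \<ge> e} \<subseteq> {v \<in> V. e\<^sup>2 \<le> (cmod (f v))\<^sup>2}"
  proof
    fix v assume "v \<in> {v. cmod (f v) \<ge> e}"
    then have v: "e \<le> cmod (f v)" by simp
    moreover have "v \<in> V"
      using v e ell2_outside[OF assms, of v] by (cases "v \<in> V") simp_all
    ultimately show "v \<in> {v \<in> V. e\<^sup>2 \<le> (cmod (f v))\<^sup>2}"
      using e by (simp add: power_mono)
  qed
  ultimately show "finite {v. cmod (f v) \<ge> e}"
    by (rule finite_subset[rotated])
qed

lemma ell2_eigenspace_eq: "ell2_eigenspace (- 2) = {f \<in> ell2. flow f}"
proof (intro equalityI subsetI)
  show "f \<in> {f \<in> ell2. flow f}" if "f \<in> ell2_eigenspace (- 2)" for f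
    using that ell2_decaying eigenfunction_imp_flow unfolding ell2_eigenspace_def by blast
  show "f \<in> ell2_eigenspace (- 2)" if "f \<in> {f \<in> ell2. flow f}" for f
  proof -
    have "f \<in> functions_on_V" "flow f" "f \<in> ell2"
      using that unfolding ell2_def by blast+
    then show ?thesis
      unfolding ell2_eigenspace_def by (simp add: flow_imp_eigenfunction)
  qed
qed

lemma flow_add: "flow f \<Longrightarrow> flow g \<Longrightarrow> flow (\<lambda>v. f v + g v)"
  unfolding flow_def by (simp add: sum.distrib)

lemma flow_scale: "flow f \<Longrightarrow> flow (\<lambda>v. c * f v)"
  unfolding flow_def by (simp flip: sum_distrib_left)

lemma flow_limit:
  assumes flow: "\<And>n. flow (s n)" and lim: "\<And>v. (\<lambda>n. s n v) \<longlonglongrightarrow> g v"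
  shows "flow g"
  unfolding flow_def
proof (intro conjI allI)
  fix i n
  have "(\<lambda>k. \<Sum>j\<in>UNIV. s k (site j n)) \<longlonglongrightarrow> (\<Sum>j\<in>UNIV. g (site j n))"
    by (intro tendsto_sum lim)
  then show "(\<Sum>j\<in>UNIV. g (site j n)) = 0"
    unfolding flow_sum[OF flow] by (simp only: LIMSEQ_const_iff)
  have "(\<lambda>k. s k (partner i n)) \<longlonglongrightarrow> - g (site i n)"
    unfolding flow_partner[OF flow] by (intro tendsto_minus lim)
  with lim show "g (partner i n) = - g (site i n)"
    by (rule LIMSEQ_unique)
qed

interpretation eigenspace: ell2_closed_subspace "ell2_eigenspace (- 2)"
proof
  show "(\<lambda>_. 0) \<in> ell2_eigenspace (- 2)"
    unfolding ell2_eigenspace_eq by (simp add: ell2_zero flow_def)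
  show "g \<in> ell2_eigenspace (- 2)"
    if "\<And>n. s n \<in> ell2_eigenspace (- 2)" "\<And>v. (\<lambda>n. s n v) \<longlonglongrightarrow> g v" "g \<in> ell2" for s g
    using that flow_limit[of s g] unfolding ell2_eigenspace_eq by blast
qed (auto simp: ell2_eigenspace_eq ell2_add ell2_scale flow_add flow_scale)

section \<open>Point masses and the kernel of the spectral projection\<close>

lemma infsum_delta:
  assumes "u \<in> A"
  shows "(\<Sum>\<^sub>\<infinity>v\<in>A. if v = u then f v else 0) = (f u :: complex)"
proof -
  have "(\<Sum>\<^sub>\<infinity>v\<in>A. if v = u then f v else 0) = (\<Sum>\<^sub>\<infinity>v\<in>{u}. f v)"
    using assms by (intro infsum_cong_neutral) auto
  then show ?thesis by simp
qed

lemma ell2_inner_delta_right: "u \<in> V \<Longrightarrow> ell2_inner f (delta u) = f u"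
  using infsum_delta[of u V f]
  by (simp add: ell2_inner_def delta_def if_distrib[of cnj] if_distrib[of "(*) _"] cong: if_cong)

lemma ell2_inner_delta_left: "u \<in> V \<Longrightarrow> ell2_inner (delta u) f = cnj (f u)"
  by (subst ell2_inner_commute) (simp add: ell2_inner_delta_right)

lemma delta_ell2:
  assumes "u \<in> V"
  shows "delta u \<in> ell2"
proof (rule ell2I)
  show "(\<lambda>v. delta u v * cnj (delta u v)) summable_on V"
    using summable_on_cong_neutral[of V "{u}" "\<lambda>v. delta u v * cnj (delta u v)" "\<lambda>v. 1"] assms
    by (auto simp: delta_def)
qed (use assms in \<open>auto simp: delta_def\<close>)

text \<open>Its value at \<open>v\<close> is the matrix entry of the spectral projection between
  \<open>delta u\<close> and \<open>delta v\<close>.\<close>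

abbreviation spectral_kernel :: "point \<Rightarrow> point \<Rightarrow> complex" where
  "spectral_kernel u \<equiv> spectral_proj (- 2) (delta u)"

lemma spectral_kernel_mem: "u \<in> V \<Longrightarrow> spectral_kernel u \<in> ell2_eigenspace (- 2)"
  unfolding spectral_proj_def by (intro eigenspace.orth_proj_mem delta_ell2)

lemma spectral_kernel_ell2: "u \<in> V \<Longrightarrow> spectral_kernel u \<in> ell2"
  using spectral_kernel_mem eigenspace.subset_ell2 by blast

lemma spectral_kernel_flow: "u \<in> V \<Longrightarrow> flow (spectral_kernel u)"
  using spectral_kernel_mem unfolding ell2_eigenspace_eq by blast

text \<open>The point mass \<open>delta u\<close> and its projection have the same inner product
  with every element of the eigenspace.\<close>

lemma spectral_kernel_reproducing:
  assumes "u \<in> V" "h \<in> ell2_eigenspace (- 2)"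
  shows "ell2_inner (spectral_kernel u) h = cnj (h u)"
proof -
  have "h \<in> ell2"
    using assms(2) eigenspace.subset_ell2 by blast
  then have "ell2_inner (\<lambda>v. delta u v - spectral_kernel u v) h = cnj (h u) - ell2_inner (spectral_kernel u) h"
    using assms(1) by (simp add: ell2_inner_diff_left ell2_inner_delta_left delta_ell2 spectral_kernel_ell2)
  moreover have "ell2_inner (\<lambda>v. delta u v - spectral_kernel u v) h = 0"
    using eigenspace.orth_proj_orthogonal[OF delta_ell2[OF assms(1)] assms(2)]
    unfolding spectral_proj_def .
  ultimately show ?thesis
    by simp
qed

lemma spectral_kernel_hermitian:
  assumes "u \<in> V" "v \<in> V"
  shows "spectral_kernel u v = cnj (spectral_kernel v u)"
proof -
  have "cnj (spectral_kernel u v) = ell2_inner (spectral_kernel v) (spectral_kernel u)"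
    by (simp only: spectral_kernel_reproducing spectral_kernel_mem assms)
  also have "\<dots> = cnj (ell2_inner (spectral_kernel u) (spectral_kernel v))"
    by (rule ell2_inner_commute)
  also have "\<dots> = spectral_kernel v u"
    by (simp only: spectral_kernel_reproducing spectral_kernel_mem assms complex_cnj_cnj)
  finally show ?thesis
    by (metis complex_cnj_cnj)
qed

section \<open>Translation invariance\<close>

lemma act_site [simp]: "act m (site i n) = site i (m + n)"
  by (cases m; cases n; cases "w $ i") (simp add: site_def act_def algebra_simps)

lemma act_partner [simp]: "act m (partner i n) = partner i (m + n)"
  by (simp add: partner_def add.assoc)

lemma act_add: "act m (act n v) = act (m + n) v"
  by (cases m; cases n; cases v) (simp add: act_def algebra_simps)

lemma act_zero [simp]: "act 0 v = v"
  by (cases v) (simp add: act_def zero_prod_def)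

lemma act_in_V: "v \<in> V \<Longrightarrow> act m v \<in> V"
  by (elim V_cases) simp

lemma act_in_V_iff [simp]: "act m v \<in> V \<longleftrightarrow> v \<in> V"
  using act_in_V[of v m] act_in_V[of "act m v" "- m"] by (auto simp: act_add)

lemma bij_betw_act: "bij_betw (act m) V V"
  by (rule bij_betw_byWitness[of _ "act (- m)"]) (auto simp: act_add)

lemma ell2_inner_act: "ell2_inner (\<lambda>v. f (act m v)) (\<lambda>v. g (act m v)) = ell2_inner f g"
  unfolding ell2_inner_def by (rule infsum_reindex_bij_betw[OF bij_betw_act])

lemma eigenspace_act:
  assumes "f \<in> ell2_eigenspace (- 2)"
  shows "(\<lambda>v. f (act m v)) \<in> ell2_eigenspace (- 2)"
proof -
  have f: "f \<in> ell2" "flow f"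
    using assms unfolding ell2_eigenspace_eq by auto
  have "(\<lambda>v. f (act m v)) \<in> ell2"
  proof (rule ell2I)
    show "(\<lambda>v. f (act m v) * cnj (f (act m v))) summable_on V"
      using summable_on_reindex_bij_betw[OF bij_betw_act, of "\<lambda>v. f v * cnj (f v)" m]
        summable_on_mult_cnj[OF f(1) f(1)] by simp
  qed (simp add: ell2_outside f(1))
  moreover have "flow (\<lambda>v. f (act m v))"
    unfolding flow_def by (simp add: flow_sum flow_partner f(2))
  ultimately show ?thesis
    unfolding ell2_eigenspace_eq by simp
qed

text \<open>Translations preserve the inner product and the eigenspace, so the translated kernel has
  the two properties that characterise the projection of \<open>delta u\<close>.\<close>

lemma spectral_kernel_act:
  assumes "u \<in> V"
  shows "spectral_kernel (act m u) (act m v) = spectral_kernel u v"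
proof -
  let ?q = "\<lambda>v. spectral_kernel (act m u) (act m v)"
  have u': "act m u \<in> V"
    using assms by simp
  have "orth_proj (ell2_eigenspace (- 2)) (delta u) = ?q"
  proof (rule eigenspace.orth_proj_eqI)
    fix h assume h: "h \<in> ell2_eigenspace (- 2)"
    let ?h = "\<lambda>v. h (act (- m) v)"
    have eq: "delta u = (\<lambda>v. delta (act m u) (act m v))"
    proof
      show "delta u v = delta (act m u) (act m v)" for v
        unfolding delta_def using act_add[of "- m" m u] act_add[of "- m" m v] by auto
    qed
    have "h = (\<lambda>v. ?h (act m v))"
      by (simp add: act_add)
    then have "ell2_inner (\<lambda>v. delta u v - ?q v) h =
        ell2_inner (\<lambda>v. (\<lambda>v. delta (act m u) v - spectral_kernel (act m u) v) (act m v)) (\<lambda>v. ?h (act m v))"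
      by (subst eq) simp
    also have "\<dots> = ell2_inner (\<lambda>v. delta (act m u) v - spectral_kernel (act m u) v) ?h"
      by (rule ell2_inner_act)
    also have "\<dots> = 0"
      unfolding spectral_proj_def
      by (rule eigenspace.orth_proj_orthogonal[OF delta_ell2[OF u'] eigenspace_act[OF h]])
    finally show "ell2_inner (\<lambda>v. delta u v - ?q v) h = 0" .
  qed (simp_all add: delta_ell2 assms eigenspace_act spectral_kernel_mem u')
  from fun_cong[OF this, of v] show ?thesis
    unfolding spectral_proj_def by (rule sym)
qed

section \<open>Dipoles on edges and plaquette flows\<close>

definition dipole :: "6 \<Rightarrow> point \<Rightarrow> point \<Rightarrow> complex" where
  "dipole i n v = delta (site i n) v - delta (partner i n) v"

lemma partner_in_V [simp]: "partner i n \<in> V"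
  by (simp add: partner_def)

lemma dipole_ell2: "dipole i n \<in> ell2"
  using ell2_diff[OF delta_ell2 delta_ell2, of "site i n" "partner i n"]
  by (simp add: dipole_def[abs_def])

text \<open>A flow takes opposite values at the two ends of an edge, as the dipole does, so both
  ends contribute the same amount.\<close>

lemma ell2_inner_dipole:
  assumes "f \<in> ell2" "flow f"
  shows "ell2_inner f (dipole i n) = 2 * f (site i n)"
proof -
  have "ell2_inner f (dipole i n) = f (site i n) - f (partner i n)"
    using ell2_inner_diff_right[OF delta_ell2 delta_ell2 assms(1), of "site i n" "partner i n"]
    by (simp add: dipole_def[abs_def] ell2_inner_delta_right)
  then show ?thesis
    by (simp add: flow_partner[OF assms(2)])
qed

lemma sum_delta_site: "(\<Sum>j\<in>UNIV. delta (site i n) (site j m)) = (if m = n then 1 else 0)"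
proof -
  have "delta (site i n) (site j m) = (if j = i then if m = n then 1 else 0 else 0)" for j
    by (simp add: delta_def)
  then show ?thesis by simp
qed

text \<open>A dipole is one unit of flow along a single edge, so its divergence sits at the two
  cells that the edge joins.\<close>

lemma sum_dipole:
  "(\<Sum>j\<in>UNIV. dipole i n (site j m)) = (if m = n then 1 else 0) - (if m = n + w $ i then 1 else 0)"
  unfolding dipole_def partner_def sum_subtractf sum_delta_site ..

lemma dipole_partner: "dipole i n (partner j m) = - dipole i n (site j m)"
proof -
  have "partner j m = site i n \<longleftrightarrow> site j m = partner i n"
  proof
    assume "partner j m = site i n"
    then have "i = j + 3" "n = m + w $ j"
      unfolding partner_def site_eq_iff by simp_all
    then show "site j m = partner i n" by simp
  next
    assume "site j m = partner i n"
    then have "j = i + 3" "m = n + w $ i"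
      unfolding partner_def site_eq_iff by simp_all
    then show "partner j m = site i n" by simp
  qed
  moreover have "partner j m = partner i n \<longleftrightarrow> site j m = site i n"
    unfolding partner_def by auto
  ultimately show ?thesis
    by (simp add: dipole_def delta_def)
qed

text \<open>The unit flow around the plaquette with corner \<open>m\<close> spanned by the directions
  \<open>w\<^sub>i\<close> and \<open>w\<^sub>1\<close>.\<close>

definition plaquette :: "6 \<Rightarrow> point \<Rightarrow> point \<Rightarrow> complex" where
  "plaquette i m v = (dipole i m v + dipole 1 (m + w $ i) v) - (dipole i (m + w $ 1) v + dipole 1 m v)"

text \<open>The divergences of the four dipoles cancel at the corners. For \<open>i = 1\<close> and
  \<open>i = 4\<close> the square degenerates and the plaquette is zero.\<close>

lemma plaquette_mem: "plaquette i m \<in> ell2_eigenspace (- 2)"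
proof -
  have "plaquette i m \<in> ell2"
    unfolding plaquette_def[abs_def] by (intro ell2_diff ell2_add dipole_ell2)
  moreover have "flow (plaquette i m)"
    unfolding flow_def plaquette_def
    by (simp add: sum.distrib sum_subtractf sum_dipole dipole_partner ac_simps)
  ultimately show ?thesis
    unfolding ell2_eigenspace_eq by simp
qed

text \<open>The pairing of the kernel with a plaquette is computed twice: dipole by dipole, and by
  the reproducing property.\<close>

lemma spectral_kernel_plaquette:
  assumes "u \<in> V"
  shows "2 * (spectral_kernel u (site i m) + spectral_kernel u (site 1 (m + w $ i))
    - spectral_kernel u (site i (m + w $ 1)) - spectral_kernel u (site 1 m)) = cnj (plaquette i m u)"
proof -
  note u = spectral_kernel_ell2[OF assms] spectral_kernel_flow[OF assms]
  have pairs: "(\<lambda>v. dipole j n v + dipole k l v) \<in> ell2"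
    "ell2_inner (spectral_kernel u) (\<lambda>v. dipole j n v + dipole k l v) =
      2 * spectral_kernel u (site j n) + 2 * spectral_kernel u (site k l)" for j k n l
    using ell2_inner_add_right[OF dipole_ell2 dipole_ell2 u(1), of j n k l]
    by (simp_all add: ell2_add dipole_ell2 ell2_inner_dipole u)
  have "ell2_inner (spectral_kernel u) (plaquette i m) =
      (2 * spectral_kernel u (site i m) + 2 * spectral_kernel u (site 1 (m + w $ i)))
      - (2 * spectral_kernel u (site i (m + w $ 1)) + 2 * spectral_kernel u (site 1 m))"
    unfolding plaquette_def[abs_def] ell2_inner_diff_right[OF pairs(1) pairs(1) u(1)] pairs(2) ..
  then show ?thesis
    unfolding spectral_kernel_reproducing[OF assms plaquette_mem] by simp
qed

section \<open>The recursion for the shifted traces\<close>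

definition trace_at :: "point \<Rightarrow> complex" where
  "trace_at m = (\<Sum>i\<in>UNIV. spectral_kernel (site i 0) (site i m))"

text \<open>By Hermitian symmetry this is the conjugate of the divergence of one kernel at the cell
  \<open>0\<close>.\<close>

lemma sum_spectral_kernel_to_site_1: "(\<Sum>i\<in>UNIV. spectral_kernel (site i 0) (site 1 m)) = 0"
proof -
  have "(\<Sum>i\<in>UNIV. spectral_kernel (site i 0) (site 1 m)) = cnj (\<Sum>i\<in>UNIV. spectral_kernel (site 1 m) (site i 0))"
    unfolding cnj_sum by (intro sum.cong refl spectral_kernel_hermitian site_in_V)
  then show ?thesis
    by (simp add: flow_sum spectral_kernel_flow)
qed

text \<open>After conjugation, passing to the other end of the edge at \<open>site i 0\<close> and
  translating back by \<open>w $ i\<close> gives, up to sign, the divergence of one kernel at the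
  cell \<open>0\<close>, with indices permuted by \<open>i + 3\<close>.\<close>

lemma sum_spectral_kernel_to_shifted_site_1: "(\<Sum>i\<in>UNIV. spectral_kernel (site i 0) (site 1 (m + w $ i))) = 0"
proof -
  have "spectral_kernel (site i 0) (site 1 (m + w $ i)) = - cnj (spectral_kernel (site 1 m) (site (i + 3) 0))" for i
  proof -
    have end_eq: "site i 0 = partner (i + 3) (w $ i)"
      using partner_partner[of i 0] by simp
    have "spectral_kernel (site i 0) (site 1 (m + w $ i)) = cnj (spectral_kernel (site 1 (m + w $ i)) (site i 0))"
      by (intro spectral_kernel_hermitian site_in_V)
    also have "spectral_kernel (site 1 (m + w $ i)) (site i 0) = - spectral_kernel (site 1 (m + w $ i)) (site (i + 3) (w $ i))"
      unfolding end_eq by (intro flow_partner spectral_kernel_flow site_in_V)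
    also have "spectral_kernel (site 1 (m + w $ i)) (site (i + 3) (w $ i)) = spectral_kernel (site 1 m) (site (i + 3) 0)"
      using spectral_kernel_act[of "site 1 m" "w $ i" "site (i + 3) 0"] by (simp add: add.commute)
    finally show ?thesis
      by simp
  qed
  then have "(\<Sum>i\<in>UNIV. spectral_kernel (site i 0) (site 1 (m + w $ i))) =
      - cnj (\<Sum>i\<in>UNIV. spectral_kernel (site 1 m) (site (i + 3) 0))"
    by (simp add: sum_negf)
  also have "(\<Sum>i\<in>UNIV. spectral_kernel (site 1 m) (site (i + 3) 0)) = (\<Sum>j\<in>UNIV. spectral_kernel (site 1 m) (site j 0))"
    by (rule sum.reindex_bij_witness[of _ "\<lambda>j. j + 3" "\<lambda>i. i + 3"]) simp_all
  finally show ?thesis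
    by (simp add: flow_sum spectral_kernel_flow)
qed

text \<open>Directions 2, 3, 5 and 6 each contribute the difference of the two indicators;
  directions 1 and 4 give zero plaquettes.\<close>

lemma sum_plaquette:
  "(\<Sum>i\<in>UNIV. plaquette i m (site i 0)) = 4 * ((if m = 0 then 1 else 0) - (if m + w $ 1 = 0 then 1 else 0))"
  by (cases m)
    (simp add: sum_6 plaquette_def dipole_def delta_def partner_def w_simps numeral_mod_6 zero_prod_def)

text \<open>The plaquette identity is summed over \<open>i\<close> with \<open>u = site i 0\<close>.
  The two sums over sites in direction 1 vanish, and the factor 2 of the identity turns the 4 of
  \<open>sum_plaquette\<close> into 2.\<close>

lemma trace_at_step:
  "trace_at m - trace_at (m + w $ 1) = 2 * ((if m = 0 then 1 else 0) - (if m + w $ 1 = 0 then 1 else 0))"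
proof -
  have "2 * (trace_at m - trace_at (m + w $ 1)) =
      2 * (trace_at m + (\<Sum>i\<in>UNIV. spectral_kernel (site i 0) (site 1 (m + w $ i)))
        - trace_at (m + w $ 1) - (\<Sum>i\<in>UNIV. spectral_kernel (site i 0) (site 1 m)))"
    unfolding sum_spectral_kernel_to_site_1 sum_spectral_kernel_to_shifted_site_1 by simp
  also have "\<dots> = (\<Sum>i\<in>UNIV. 2 * (spectral_kernel (site i 0) (site i m) + spectral_kernel (site i 0) (site 1 (m + w $ i))
        - spectral_kernel (site i 0) (site i (m + w $ 1)) - spectral_kernel (site i 0) (site 1 m)))"
    unfolding trace_at_def sum.distrib[symmetric] sum_subtractf[symmetric] sum_distrib_left ..
  also have "\<dots> = cnj (\<Sum>i\<in>UNIV. plaquette i m (site i 0))"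
    by (simp only: spectral_kernel_plaquette site_in_V cnj_sum)
  also have "\<dots> = 2 * (2 * ((if m = 0 then 1 else 0) - (if m + w $ 1 = 0 then 1 else 0)))"
    unfolding sum_plaquette by simp
  finally show ?thesis
    unfolding mult_cancel_left by simp
qed

lemma trace_at_0: "trace_at 0 = 2"
proof -
  \<comment> \<open>Starting at \<open>Suc k\<close> avoids the cell \<open>0\<close>, where the
    recursion has a nonzero right side; beyond it \<open>trace_at\<close> is constant, so decay
    makes it zero.\<close>
  have "trace_at (int (Suc k), 0, 0) = trace_at (1, 0, 0)" for k
  proof (induction k)
    case (Suc k)
    then show ?case
      using trace_at_step[of "(int (Suc k), 0, 0)"] by (simp add: w_simps zero_prod_def)
  qed simp
  moreover have "(\<lambda>k. trace_at (int (Suc k), 0, 0)) \<longlonglongrightarrow> (\<Sum>i\<in>(UNIV::6 set). 0)"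
    unfolding trace_at_def
  proof (intro tendsto_sum)
    fix i
    have "(\<lambda>k. spectral_kernel (site i 0) (site i (0 + int k, 0, 0))) \<longlonglongrightarrow> 0"
      using ell2_decaying[OF spectral_kernel_ell2[OF site_in_V]] unfolding decaying_def by blast
    from LIMSEQ_Suc[OF this]
    show "(\<lambda>k. spectral_kernel (site i 0) (site i (int (Suc k), 0, 0))) \<longlonglongrightarrow> 0"
      by simp
  qed
  ultimately have "trace_at (1, 0, 0) = 0"
    by (simp add: LIMSEQ_const_iff)
  then show ?thesis
    using trace_at_step[of 0] by (simp add: w_simps zero_prod_def)
qed

lemma spectral_proj_zero: "spectral_proj (- 2) (\<lambda>_. 0) = (\<lambda>_. 0)"
  unfolding spectral_proj_def
  by (rule eigenspace.orth_proj_eqI) (simp_all add: ell2_zero eigenspace.zero ell2_inner_def)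

text \<open>Restriction to \<open>W\<close> kills every point mass outside \<open>W\<close>, so the
  infinite trace is a sum of six diagonal entries.\<close>

lemma trace_spectral_proj: "trace_ell2 (spectral_proj (- 2) \<circ> restrict_W) = trace_at 0"
proof -
  have "W \<subseteq> V"
    by (auto simp: W_eq_sites)
  have restrict: "restrict_W (delta v) = (if v \<in> W then delta v else (\<lambda>_. 0))" for v
    by (auto simp: restrict_W_def delta_def)
  have "trace_ell2 (spectral_proj (- 2) \<circ> restrict_W) = (\<Sum>\<^sub>\<infinity>v\<in>V. if v \<in> W then spectral_kernel v v else 0)"
    unfolding trace_ell2_def
    by (intro infsum_cong) (simp add: restrict ell2_inner_delta_right spectral_proj_zero)
  also have "\<dots> = (\<Sum>\<^sub>\<infinity>v\<in>W. spectral_kernel v v)"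
    using \<open>W \<subseteq> V\<close> by (intro infsum_cong_neutral) auto
  also have "\<dots> = (\<Sum>v\<in>W. spectral_kernel v v)"
    by (simp add: W_eq_sites)
  also have "\<dots> = trace_at 0"
    unfolding W_eq_sites trace_at_def by (subst sum.reindex) (auto simp: inj_def)
  finally show ?thesis .
qed

lemma density_of_states_eq: "density_of_states (- 2) = 1 / 3"
proof -
  have "card W = 6"
    unfolding W_eq_sites by (subst card_image) (auto simp: inj_def)
  then show ?thesis
    by (simp add: density_of_states_def trace_spectral_proj trace_at_0)
qed

theorem proposition7p1:
  shows
    "module.span (*s) {f1, f2, f3} = eigenmodule (- 2) \<and>
     {h :: laurent ^ 3. h $ 1 *s f1 + h $ 2 *s f2 + h $ 3 *s f3 = 0}
       = module.span (*s) {vector [1 - X, 1 - Y, 1 - Z]} \<and>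
     module_hom (*) (*s) first_map \<and>
     module_hom (*s) (*s) second_map \<and>
     inj first_map \<and>
     range first_map = {h. second_map h = 0} \<and>
     range second_map = eigenmodule (- 2) \<and>
     density_of_states (- 2) = 1 / 6 * (3 - 1) \<and>
     density_of_states (- 2) = 1 / 3"
proof (intro conjI)
  show "module.span (*s) {f1, f2, f3} = eigenmodule (- 2)"
    by (simp only: span_f range_second_map)
  have "{h :: laurent ^ 3. h $ 1 *s f1 + h $ 2 *s f2 + h $ 3 *s f3 = 0} = {h. second_map h = 0}"
    by (simp only: second_map_def)
  also have "\<dots> = range first_map"
    by (simp only: second_map_kernel Collect_mem_eq)
  finally show "{h :: laurent ^ 3. h $ 1 *s f1 + h $ 2 *s f2 + h $ 3 *s f3 = 0}
      = module.span (*s) {vector [1 - X, 1 - Y, 1 - Z]}"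
    by (simp only: span_syzygy)
  show "range first_map = {h. second_map h = 0}"
    by (simp only: second_map_kernel Collect_mem_eq)
  show "density_of_states (- 2) = 1 / 6 * (3 - 1)"
    by (simp add: density_of_states_eq)
qed (fact module_hom_first_map module_hom_second_map inj_first_map range_second_map
    density_of_states_eq)+

end
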